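(* Let $X$ be a smooth vector field on an $m$-dimensional smooth manifold $M$ admitting a first integral $h\in C^\infty(M)$ with no critical points. Suppose that $X$ is tangent to a $2$-dimensional regular foliation $\mathcal{S}$ transversal to the level sets of $h$. Then there exists a unique Poisson structure on $M$ of the form $\pi=Y\wedge X$, for some $Y\in\Gamma(TM)$, such that $\pi^\sharp\mathrm{d}h=X$ on $M$, the symplectic foliation of $\pi$ coincides with $\mathcal{S}$ on the open set $\{\operatorname{rank}\pi=2\}$, and $\pi$ vanishes at the set $\{X=0\}$. Moreover, on any foliated coordinate chart $(U;\boldsymbol{x}=(x_1,\dots,x_{m-2}),\boldsymbol{y}=(y_1,y_2))$ for $\mathcal{S}$ such that $y_1=h$, one has $\pi|_U=\frac{\partial}{\partial y_1}\wedge X$.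
   Context: A Poisson structure is a bivector field $\pi$ with $[\pi,\pi]=0$ (Schouten–Nijenhuis bracket); $\pi^\sharp\alpha=\mathbf{i}_\alpha\pi=\pi(\alpha,\cdot)$, so $(Y\wedge X)^\sharp\alpha=\alpha(Y)X-\alpha(X)Y$. The rank of $\pi$ at $x$ is $\dim\pi^\sharp(T_x^*M)$, and the symplectic foliation is the (possibly singular) foliation integrating $\pi^\sharp(T^*M)$; thus on $\{\operatorname{rank}\pi=2\}$ the condition means $\pi^\sharp(T^*M)=T\mathcal{S}$. A first integral of $X$ is a function $h$ with $\mathrm{d}h(X)=0$. A foliated chart for $\mathcal{S}$ is one in which the leaves of $\mathcal{S}|_U$ are the level sets of $\boldsymbol{x}$. *)

theory Defs
  imports "HOL-Analysis.Analysis" "HOL-Library.Function_Algebras"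
begin

section \<open>Pointwise real vector space structure on functions\<close>

text \<open>Tangent vectors and covectors below are functions; this instance makes \<^const>\<open>dim\<close>
  available for spaces of them. The additive structure is the one of
  \<open>HOL-Library.Function_Algebras\<close>, so \<open>0\<close> is the zero function.\<close>

instantiation "fun" :: (type, real_vector) real_vector
begin

definition scaleR_fun :: "real \<Rightarrow> ('a \<Rightarrow> 'b) \<Rightarrow> 'a \<Rightarrow> 'b"
  where "scaleR_fun r f = (\<lambda>x. r *\<^sub>R f x)"

instance
  by standard (auto simp: scaleR_fun_def fun_eq_iff algebra_simps)

end

definition dual_space :: "'v::real_vector set \<Rightarrow> ('v \<Rightarrow> real) set"
  where "dual_space V =
    {\<alpha>. (\<forall>u\<in>V. \<forall>v\<in>V. \<forall>a b. \<alpha> (a *\<^sub>R u + b *\<^sub>R v) = a * \<alpha> u + b * \<alpha> v) \<and> (\<forall>v. v \<notin> V \<longrightarrow> \<alpha> v = 0)}"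


section \<open>Smooth maps between Euclidean spaces\<close>

text \<open>Both notions are meant for open \<open>S\<close>.\<close>

primrec Ck_on :: "nat \<Rightarrow> 'a::euclidean_space set \<Rightarrow> ('a \<Rightarrow> 'b::euclidean_space) \<Rightarrow> bool" where
  "Ck_on 0 = (\<lambda>S f. continuous_on S f)"
| "Ck_on (Suc k) = (\<lambda>S f. (\<forall>x\<in>S. f differentiable (at x)) \<and>
     (\<forall>v. Ck_on k S (\<lambda>x. frechet_derivative f (at x) v)))"

definition smooth_on :: "'a::euclidean_space set \<Rightarrow> ('a \<Rightarrow> 'b::euclidean_space) \<Rightarrow> bool"
  where "smooth_on S f \<longleftrightarrow> (\<forall>k. Ck_on k S f)"


section \<open>Smooth manifolds\<close>

text \<open>The manifold is the whole type \<open>'a\<close>, its dimension is \<open>CARD('m)\<close>. A chart is a pair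
  \<open>(U, \<phi>)\<close>; the values of \<open>\<phi>\<close> outside \<open>U\<close> are irrelevant.\<close>

type_synonym ('a, 'm) chart = "'a set \<times> ('a \<Rightarrow> real ^ 'm)"

definition is_chart :: "('a::topological_space, 'm::finite) chart \<Rightarrow> bool"
  where "is_chart c \<longleftrightarrow> open (fst c) \<and> open (snd c ` fst c) \<and>
    homeomorphism (fst c) (snd c ` fst c) (snd c) (inv_into (fst c) (snd c))"

definition in_chart :: "('a, 'm) chart \<Rightarrow> ('a \<Rightarrow> 'b) \<Rightarrow> real ^ 'm::finite \<Rightarrow> 'b"
  where "in_chart c f = f \<circ> inv_into (fst c) (snd c)"

definition transition :: "('a, 'm::finite) chart \<Rightarrow> ('a, 'm) chart \<Rightarrow> real ^ 'm \<Rightarrow> real ^ 'm"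
  where "transition c c' = in_chart c (snd c')"

definition compatible :: "('a, 'm::finite) chart \<Rightarrow> ('a, 'm) chart \<Rightarrow> bool"
  where "compatible c c' \<longleftrightarrow>
    smooth_on (snd c ` (fst c \<inter> fst c')) (transition c c') \<and>
    smooth_on (snd c' ` (fst c \<inter> fst c')) (transition c' c)"

text \<open>\<open>A\<close> is a maximal smooth atlas.\<close>

definition smooth_manifold ::
  "('a::{t2_space,second_countable_topology}, 'm::finite) chart set \<Rightarrow> bool"
  where "smooth_manifold A \<longleftrightarrow>
    (\<forall>c\<in>A. is_chart c) \<and> \<Union> (fst ` A) = UNIV \<and> (\<forall>c\<in>A. \<forall>c'\<in>A. compatible c c') \<and>
    (\<forall>c. is_chart c \<and> (\<forall>c'\<in>A. compatible c c') \<longrightarrow> c \<in> A)"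

definition charts_at :: "('a, 'm) chart set \<Rightarrow> 'a \<Rightarrow> ('a, 'm) chart set"
  where "charts_at A p = {c \<in> A. p \<in> fst c}"

definition smooth_function :: "('a, 'm::finite) chart set \<Rightarrow> ('a \<Rightarrow> real) \<Rightarrow> bool"
  where "smooth_function A f \<longleftrightarrow> (\<forall>c\<in>A. smooth_on (snd c ` fst c) (in_chart c f))"


section \<open>Tangent vectors, covectors, vector fields\<close>

text \<open>A tangent vector at \<open>p\<close> is the family of its components in all charts around \<open>p\<close>, related by
  the Jacobians of the transition maps, and extended by \<open>0\<close> to pairs that are not charts
  around \<open>p\<close>.\<close>

type_synonym ('a, 'm) tvec = "('a, 'm) chart \<Rightarrow> real ^ 'm"

definition tangent_space :: "('a, 'm::finite) chart set \<Rightarrow> 'a \<Rightarrow> ('a, 'm) tvec set"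
  where "tangent_space A p =
    {v. (\<forall>c\<in>charts_at A p. \<forall>c'\<in>charts_at A p.
           v c' = frechet_derivative (transition c c') (at (snd c p)) (v c)) \<and>
        (\<forall>c. c \<notin> charts_at A p \<longrightarrow> v c = 0)}"

definition cotangent_space ::
  "('a, 'm::finite) chart set \<Rightarrow> 'a \<Rightarrow> (('a, 'm) tvec \<Rightarrow> real) set"
  where "cotangent_space A p = dual_space (tangent_space A p)"

text \<open>The value does not depend on the chart chosen around \<open>p\<close>; \<open>f\<close> only needs to be smooth
  near \<open>p\<close>.\<close>

definition differential ::
  "('a, 'm::finite) chart set \<Rightarrow> ('a \<Rightarrow> real) \<Rightarrow> 'a \<Rightarrow> ('a, 'm) tvec \<Rightarrow> real"
  where "differential A f p v =
    (if v \<in> tangent_space A p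
     then let c = (SOME c. c \<in> charts_at A p)
          in frechet_derivative (in_chart c f) (at (snd c p)) (v c)
     else 0)"

definition coord_vector ::
  "('a, 'm::finite) chart set \<Rightarrow> ('a, 'm) chart \<Rightarrow> 'm \<Rightarrow> 'a \<Rightarrow> ('a, 'm) tvec"
  where "coord_vector A c i p = (THE v. v \<in> tangent_space A p \<and> v c = axis i 1)"

definition coord_covector ::
  "('a, 'm::finite) chart set \<Rightarrow> ('a, 'm) chart \<Rightarrow> 'm \<Rightarrow> 'a \<Rightarrow> ('a, 'm) tvec \<Rightarrow> real"
  where "coord_covector A c i = differential A (\<lambda>q. snd c q $ i)"

definition vector_field ::
  "('a, 'm::finite) chart set \<Rightarrow> ('a \<Rightarrow> ('a, 'm) tvec) \<Rightarrow> bool"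
  where "vector_field A X \<longleftrightarrow>
    (\<forall>p. X p \<in> tangent_space A p) \<and>
    (\<forall>c\<in>A. smooth_on (snd c ` fst c) (in_chart c (\<lambda>p. X p c)))"


section \<open>Bivector fields and Poisson structures\<close>

text \<open>A bivector at \<open>p\<close> is a skew-symmetric bilinear form on the cotangent space, extended by \<open>0\<close>
  to arguments that are not covectors at \<open>p\<close>.\<close>

type_synonym ('a, 'm) bivec =
  "(('a, 'm) tvec \<Rightarrow> real) \<Rightarrow> (('a, 'm) tvec \<Rightarrow> real) \<Rightarrow> real"

definition bivectors :: "('a, 'm::finite) chart set \<Rightarrow> 'a \<Rightarrow> ('a, 'm) bivec set"
  where "bivectors A p =
    {B. (\<forall>\<alpha>\<in>cotangent_space A p. B \<alpha> \<in> dual_space (cotangent_space A p)) \<and>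
        (\<forall>\<alpha>\<in>cotangent_space A p. \<forall>\<beta>\<in>cotangent_space A p. B \<alpha> \<beta> = - B \<beta> \<alpha>) \<and>
        (\<forall>\<alpha>. \<alpha> \<notin> cotangent_space A p \<longrightarrow> B \<alpha> = 0)}"

definition bivector_comp ::
  "('a, 'm::finite) chart set \<Rightarrow> ('a \<Rightarrow> ('a, 'm) bivec) \<Rightarrow> ('a, 'm) chart \<Rightarrow> 'm \<Rightarrow> 'm \<Rightarrow> 'a \<Rightarrow> real"
  where "bivector_comp A \<pi> c i j p = \<pi> p (coord_covector A c i p) (coord_covector A c j p)"

definition bivector_field ::
  "('a, 'm::finite) chart set \<Rightarrow> ('a \<Rightarrow> ('a, 'm) bivec) \<Rightarrow> bool"
  where "bivector_field A \<pi> \<longleftrightarrow>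
    (\<forall>p. \<pi> p \<in> bivectors A p) \<and>
    (\<forall>c\<in>A. \<forall>i j. smooth_on (snd c ` fst c) (in_chart c (bivector_comp A \<pi> c i j)))"

definition wedge ::
  "('a, 'm::finite) chart set \<Rightarrow> ('a \<Rightarrow> ('a, 'm) tvec) \<Rightarrow> ('a \<Rightarrow> ('a, 'm) tvec) \<Rightarrow> 'a \<Rightarrow> ('a, 'm) bivec"
  where "wedge A Y X p \<alpha> \<beta> =
    (if \<alpha> \<in> cotangent_space A p \<and> \<beta> \<in> cotangent_space A p
     then \<alpha> (Y p) * \<beta> (X p) - \<alpha> (X p) * \<beta> (Y p) else 0)"

text \<open>The contraction of \<open>\<pi>\<close> with \<open>\<alpha>\<close> in its first argument, read as a tangent vector through the
  identification of the tangent space with its bidual.\<close>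

definition sharp ::
  "('a, 'm::finite) chart set \<Rightarrow> ('a \<Rightarrow> ('a, 'm) bivec) \<Rightarrow> 'a \<Rightarrow> (('a, 'm) tvec \<Rightarrow> real) \<Rightarrow> ('a, 'm) tvec"
  where "sharp A \<pi> p \<alpha> =
    (THE v. v \<in> tangent_space A p \<and> (\<forall>\<beta>\<in>cotangent_space A p. \<beta> v = \<pi> p \<alpha> \<beta>))"

definition rank_at ::
  "('a, 'm::finite) chart set \<Rightarrow> ('a \<Rightarrow> ('a, 'm) bivec) \<Rightarrow> 'a \<Rightarrow> nat"
  where "rank_at A \<pi> p = dim (sharp A \<pi> p ` cotangent_space A p)"

definition partial ::
  "('a, 'm::finite) chart \<Rightarrow> 'm \<Rightarrow> ('a \<Rightarrow> real) \<Rightarrow> 'a \<Rightarrow> real"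
  where "partial c l f p = frechet_derivative (in_chart c f) (at (snd c p)) (axis l 1)"

text \<open>Components, in the chart \<open>c\<close>, of the Schouten--Nijenhuis bracket \<open>[P, Q]\<close> of bivector fields,
  a trivector field \<open>1/6 \<Sum> [P,Q]\<^sup>i\<^sup>j\<^sup>k \<partial>\<^sub>i \<and> \<partial>\<^sub>j \<and> \<partial>\<^sub>k\<close>. The formula results from
  \<open>P = 1/2 \<Sum> P\<^sup>i\<^sup>j \<partial>\<^sub>i \<and> \<partial>\<^sub>j\<close>, \<open>Q = 1/2 \<Sum> Q\<^sup>i\<^sup>j \<partial>\<^sub>i \<and> \<partial>\<^sub>j\<close> and the extension of the Lie bracket
  to decomposable bivectors
  \<open>[X\<^sub>1 \<and> X\<^sub>2, Y\<^sub>1 \<and> Y\<^sub>2] = [X\<^sub>1,Y\<^sub>1] \<and> X\<^sub>2 \<and> Y\<^sub>2 - [X\<^sub>1,Y\<^sub>2] \<and> X\<^sub>2 \<and> Y\<^sub>1 - [X\<^sub>2,Y\<^sub>1] \<and> X\<^sub>1 \<and> Y\<^sub>2 + [X\<^sub>2,Y\<^sub>2] \<and> X\<^sub>1 \<and> Y\<^sub>1\<close>.\<close>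

definition schouten_bracket ::
  "('a, 'm::finite) chart set \<Rightarrow> ('a \<Rightarrow> ('a, 'm) bivec) \<Rightarrow> ('a \<Rightarrow> ('a, 'm) bivec) \<Rightarrow>
    ('a, 'm) chart \<Rightarrow> 'm \<Rightarrow> 'm \<Rightarrow> 'm \<Rightarrow> 'a \<Rightarrow> real"
  where "schouten_bracket A P Q c i j k p =
    (let S = (\<lambda>i j k. \<Sum>l\<in>UNIV.
           bivector_comp A P c i l p * partial c l (bivector_comp A Q c j k) p +
           bivector_comp A Q c i l p * partial c l (bivector_comp A P c j k) p)
     in S i j k + S j k i + S k i j)"

definition poisson_structure ::
  "('a, 'm::finite) chart set \<Rightarrow> ('a \<Rightarrow> ('a, 'm) bivec) \<Rightarrow> bool"
  where "poisson_structure A \<pi> \<longleftrightarrow> bivector_field A \<pi> \<and>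
    (\<forall>c\<in>A. \<forall>p\<in>fst c. \<forall>i j k. schouten_bracket A \<pi> \<pi> c i j k p = 0)"


section \<open>Submanifolds and foliations\<close>

definition smooth_curve ::
  "('a::topological_space, 'm::finite) chart set \<Rightarrow> real set \<Rightarrow> (real \<Rightarrow> 'a) \<Rightarrow> bool"
  where "smooth_curve A J \<gamma> \<longleftrightarrow> continuous_on J \<gamma> \<and>
    (\<forall>c\<in>A. smooth_on (J \<inter> \<gamma> -` fst c) (snd c \<circ> \<gamma>))"

definition velocity ::
  "('a, 'm::finite) chart set \<Rightarrow> (real \<Rightarrow> 'a) \<Rightarrow> real \<Rightarrow> ('a, 'm) tvec"
  where "velocity A \<gamma> t =
    (\<lambda>c. if c \<in> charts_at A (\<gamma> t) then vector_derivative (snd c \<circ> \<gamma>) (at t) else 0)"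

text \<open>For a leaf of a foliation, or a regular level set of a function, this is its tangent space
  at \<open>p\<close>, as a subspace of the tangent space of the manifold.\<close>

definition tangent_to ::
  "('a::topological_space, 'm::finite) chart set \<Rightarrow> 'a set \<Rightarrow> 'a \<Rightarrow> ('a, 'm) tvec set"
  where "tangent_to A N p =
    {velocity A \<gamma> 0 | \<gamma> e. e > 0 \<and> smooth_curve A {-e<..<e} \<gamma> \<and> \<gamma> ` {-e<..<e} \<subseteq> N \<and> \<gamma> 0 = p}"

text \<open>The leaves of the restriction of a foliation \<open>F\<close> to \<open>U\<close> are the components of \<open>L \<inter> U\<close>,
  \<open>L \<in> F\<close>, in the leaf topology of \<open>L\<close>. A path of \<open>M\<close> inside a leaf stays locally in one plaque,
  so these are the path components of \<open>L \<inter> U\<close> in the topology of \<open>M\<close>. (Connected components in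
  the topology of \<open>M\<close> could be larger.)\<close>

definition leaves_on :: "'a::topological_space set set \<Rightarrow> 'a set \<Rightarrow> 'a set set"
  where "leaves_on F U = (\<Union>L\<in>F. path_components_of (top_of_set (L \<inter> U)))"

text \<open>\<open>I\<close> is the set of indices of the coordinates \<open>\<^bold>y\<close> along the leaves; the coordinates \<open>\<^bold>x\<close> are
  those with index in \<open>- I\<close>.\<close>

definition foliated_chart ::
  "('a::topological_space, 'm::finite) chart set \<Rightarrow> 'a set set \<Rightarrow> 'm set \<Rightarrow> ('a, 'm) chart \<Rightarrow> bool"
  where "foliated_chart A F I c \<longleftrightarrow> c \<in> A \<and>
    leaves_on F (fst c) = {{q \<in> fst c. \<forall>i\<in>- I. snd c q $ i = snd c p $ i} | p. p \<in> fst c}"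

text \<open>Foliated charts make every leaf an injectively immersed submanifold of dimension \<open>k\<close>, with
  plaques as local pieces; path connectedness in \<open>M\<close> is then connectedness in the leaf topology.\<close>

definition regular_foliation ::
  "('a::topological_space, 'm::finite) chart set \<Rightarrow> nat \<Rightarrow> 'a set set \<Rightarrow> bool"
  where "regular_foliation A k F \<longleftrightarrow>
    partition_on UNIV F \<and> (\<forall>L\<in>F. path_connected L) \<and>
    (\<forall>p. \<exists>c I. p \<in> fst c \<and> card I = k \<and> foliated_chart A F I c)"

definition foliation_tangent ::
  "('a::topological_space, 'm::finite) chart set \<Rightarrow> 'a set set \<Rightarrow> 'a \<Rightarrow> ('a, 'm) tvec set"
  where "foliation_tangent A F p = (\<Union>L\<in>{L \<in> F. p \<in> L}. tangent_to A L p)"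

definition transversal ::
  "('a::topological_space, 'm::finite) chart set \<Rightarrow> 'a set set \<Rightarrow> 'a set set \<Rightarrow> bool"
  where "transversal A F G \<longleftrightarrow> (\<forall>L\<in>F. \<forall>N\<in>G. \<forall>p\<in>L \<inter> N.
    {u + w | u w. u \<in> tangent_to A L p \<and> w \<in> tangent_to A N p} = tangent_space A p)"

end

theory Submission
  imports Defs
begin

text \<open>Write \<open>T\<S>\<close> for the tangent distribution of the foliation. By transversality \<open>dh\<close> does not
  vanish on \<open>T\<S>\<close>, so there is a vector field \<open>Y\<close> tangent to the leaves with \<open>dh(Y) = 1\<close>; then
  \<open>\<pi> = Y \<and> X\<close> satisfies \<open>\<pi>\<^sup>\<sharp>dh = X\<close>. The bracket \<open>[\<pi>, \<pi>]\<close> is a multiple of \<open>X \<and> Y \<and> [X, Y]\<close>, which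
  vanishes because \<open>X\<close>, \<open>Y\<close> and \<open>[X, Y]\<close> all lie in the plane \<open>T\<S>\<close>. Conversely, where \<open>X \<noteq> 0\<close> every
  adapted \<open>\<pi> = Y \<and> X\<close> has \<open>dh(Y) = 1\<close> and \<open>Y \<in> T\<S>\<close>. Since \<open>X\<close> spans the kernel of \<open>dh\<close> on \<open>T\<S>\<close>, this
  determines \<open>Y\<close> up to a multiple of \<open>X\<close>, hence \<open>\<pi>\<close>; the coordinate field \<open>\<partial>/\<partial>y\<^sub>1\<close> of an adapted chart
  is one such \<open>Y\<close>.\<close>

section \<open>Calculus of smooth maps\<close>

text \<open>The field Y itself is not unique: adding a multiple of X does not change Y \<and> X, and
  at a zero of X nothing constrains Y. Comparisons are therefore made pointwise between bivectors,
  separately for X = 0, where Y \<and> X is zero, and for X \<noteq> 0. In the second case sharp(dh)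
  = X forces dh(Y) = 1; with dh(X) = 0 this makes X and Y independent, so the rank is 2, and only
  then does the condition on the symplectic foliation apply and put Y into the tangent plane of the
  leaf. The obstacle to existence is globality: solutions of dh(Y) = 1 along the leaves are explicit
  in each foliated chart, but must be joined smoothly. Leaves enter as bare sets whose tangent
  vectors are velocities of curves, so even the linearity of their tangent spaces has to be proved.
  Foliated charts turn tangency into the vanishing of transverse components; the transverse
  coordinates are functions annihilated by X and Y, hence by [X, Y].\<close>

lemma Ck_on_subset: "Ck_on k S f \<Longrightarrow> T \<subseteq> S \<Longrightarrow> Ck_on k T f"
  by (induction k arbitrary: f) (auto intro: continuous_on_subset)

text \<open>A derivative at a point sees only a neighbourhood, so agreement on an open set passes to
  the derivatives and, by induction, to all orders.\<close>

lemma Ck_on_cong: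
  assumes "open S" "\<And>x. x \<in> S \<Longrightarrow> f x = g x" "Ck_on k S f"
  shows "Ck_on k S g"
  using assms(2,3)
proof (induction k arbitrary: f g)
  case 0
  then show ?case by (metis Ck_on.simps(1) continuous_on_cong)
next
  case (Suc k)
  have D: "(g has_derivative frechet_derivative f (at x)) (at x)" if "x \<in> S" for x
    using Suc.prems that assms(1) has_derivative_transform_within_open
    by (metis Ck_on.simps(2) frechet_derivative_works)
  have "frechet_derivative g (at x) = frechet_derivative f (at x)" if "x \<in> S" for x
    using D[OF that] frechet_derivative_at by metis
  then have "Ck_on k S (\<lambda>x. frechet_derivative g (at x) v)" for v
    using Suc.IH[of "\<lambda>x. frechet_derivative f (at x) v"] Suc.prems by auto
  then show ?case using D by (auto simp: differentiable_def)
qed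

text \<open>Lets the closure proofs below supply whatever derivative formula the calculus rules
  give, in place of \<open>frechet_derivative\<close>.\<close>

lemma Ck_on_SucI:
  assumes "open S" "\<And>x. x \<in> S \<Longrightarrow> (f has_derivative f' x) (at x)"
    "\<And>v. Ck_on k S (\<lambda>x. f' x v)"
  shows "Ck_on (Suc k) S f"
proof -
  have "f' x = frechet_derivative f (at x)" if "x \<in> S" for x
    using assms(2)[OF that] by (rule frechet_derivative_at)
  then have "Ck_on k S (\<lambda>x. frechet_derivative f (at x) v)" for v
    by (intro Ck_on_cong[OF assms(1) _ assms(3)[of v]]) simp
  then show ?thesis using assms(2) by (auto simp: differentiable_def)
qed

lemma Ck_on_SucD: "Ck_on (Suc k) S f \<Longrightarrow> Ck_on k S f"
proof (induction k arbitrary: f)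
  case 0
  then show ?case
    by (auto intro!: continuous_at_imp_continuous_on differentiable_imp_continuous_within)
next
  case (Suc k)
  then show ?case by (metis Ck_on.simps(2))
qed

lemma Ck_on_has_derivative:
  "Ck_on (Suc k) S f \<Longrightarrow> x \<in> S \<Longrightarrow> (f has_derivative frechet_derivative f (at x)) (at x)"
  by (simp add: frechet_derivative_works[symmetric])

lemma Ck_on_local:
  assumes "\<And>x. x \<in> S \<Longrightarrow> \<exists>T. open T \<and> x \<in> T \<and> Ck_on k T f"
  shows "Ck_on k S f"
  using assms
proof (induction k arbitrary: f)
  case 0
  then show ?case
    by (metis Ck_on.simps(1) continuous_at_imp_continuous_on continuous_on_eq_continuous_at)
next
  case (Suc k)
  have "Ck_on k S (\<lambda>x. frechet_derivative f (at x) v)" for v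
    by (rule Suc.IH) (metis Suc.prems Ck_on.simps(2))
  moreover have "f differentiable (at x)" if "x \<in> S" for x
    using Suc.prems[OF that] by auto
  ultimately show ?case by auto
qed

lemma Ck_on_const: "Ck_on k S (\<lambda>x. c)"
  by (induction k arbitrary: c) auto

lemma Ck_on_add:
  assumes "open S" "Ck_on k S f" "Ck_on k S g"
  shows "Ck_on k S (\<lambda>x. f x + g x)"
  using assms(2,3)
proof (induction k arbitrary: f g)
  case 0
  then show ?case by (auto intro: continuous_on_add)
next
  case (Suc k)
  show ?case
    by (rule Ck_on_SucI[OF assms(1) has_derivative_add[OF Ck_on_has_derivative[OF Suc.prems(1)]
            Ck_on_has_derivative[OF Suc.prems(2)]]])
      (use Suc in auto)
qed

lemma Ck_on_bounded_linear:
  fixes g :: "'a::euclidean_space \<Rightarrow> 'b::euclidean_space" and f :: "'b \<Rightarrow> 'c::euclidean_space"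
  assumes "open S" "bounded_linear f" "Ck_on k S g"
  shows "Ck_on k S (\<lambda>x. f (g x))"
  using assms(3)
proof (induction k arbitrary: g)
  case 0
  then show ?case by (auto intro: bounded_linear.continuous_on[OF assms(2)])
next
  case (Suc k)
  show ?case
    by (rule Ck_on_SucI[OF assms(1)
          bounded_linear.has_derivative[OF assms(2) Ck_on_has_derivative[OF Suc.prems]]])
      (use Suc in auto)
qed

lemma Ck_on_bounded_bilinear:
  fixes f :: "'a::euclidean_space \<Rightarrow> 'b::euclidean_space"
    and g :: "'a \<Rightarrow> 'c::euclidean_space" and times :: "'b \<Rightarrow> 'c \<Rightarrow> 'd::euclidean_space"
  assumes "open S" "bounded_bilinear times" "Ck_on k S f" "Ck_on k S g"
  shows "Ck_on k S (\<lambda>x. times (f x) (g x))"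
  using assms(3,4)
proof (induction k arbitrary: f g)
  case 0
  then show ?case by (auto intro: bounded_bilinear.continuous_on[OF assms(2)])
next
  case (Suc k)
  \<comment> \<open>The product rule pairs each factor itself with the derivative of the other, so
    the factors are needed at order k too.\<close>
  have "Ck_on k S f" "Ck_on k S g"
    by (rule Suc.prems[THEN Ck_on_SucD])+
  then show ?case
    by (intro Ck_on_SucI[OF assms(1) bounded_bilinear.FDERIV[OF assms(2)
            Ck_on_has_derivative[OF Suc.prems(1)] Ck_on_has_derivative[OF Suc.prems(2)]]]
          Ck_on_add assms(1) Suc.IH)
      (use Suc.prems in auto)
qed

lemma Ck_on_sum:
  assumes "open S" "\<And>i. i \<in> I \<Longrightarrow> Ck_on k S (f i)"
  shows "Ck_on k S (\<lambda>x. \<Sum>i\<in>I. f i x)"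
  using assms(2)
  by (induction I rule: infinite_finite_induct) (auto intro: Ck_on_const Ck_on_add assms(1))

lemma linear_euclidean_expansion:
  fixes L :: "'a::euclidean_space \<Rightarrow> 'b::real_vector"
  assumes "linear L"
  shows "L v = (\<Sum>b\<in>Basis. (v \<bullet> b) *\<^sub>R L b)"
proof -
  have "L v = L (\<Sum>b\<in>Basis. (v \<bullet> b) *\<^sub>R b)" by (simp add: euclidean_representation)
  also have "\<dots> = (\<Sum>b\<in>Basis. (v \<bullet> b) *\<^sub>R L b)"
    by (simp add: linear_sum[OF assms] linear_cmul[OF assms])
  finally show ?thesis .
qed

text \<open>\<open>Ck_on\<close> controls derivatives in fixed directions only. Expanding a varying
  direction in the basis turns the value into a finite sum of products of functions of order
  k.\<close>

lemma Ck_on_apply_derivative: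
  fixes D :: "'a::euclidean_space \<Rightarrow> 'b::euclidean_space \<Rightarrow> 'c::euclidean_space"
  assumes "open S" "\<And>x. x \<in> S \<Longrightarrow> linear (D x)" "\<And>v. Ck_on k S (\<lambda>x. D x v)" "Ck_on k S w"
  shows "Ck_on k S (\<lambda>x. D x (w x))"
proof -
  have "Ck_on k S (\<lambda>x. w x \<bullet> b)" for b
    by (rule Ck_on_bounded_linear[OF assms(1) bounded_linear_inner_left assms(4)])
  then have "Ck_on k S (\<lambda>x. \<Sum>b\<in>Basis. (w x \<bullet> b) *\<^sub>R D x b)"
    using assms by (simp add: Ck_on_sum Ck_on_bounded_bilinear[OF _ bounded_bilinear_scaleR])
  then show ?thesis
    by (rule Ck_on_cong[OF assms(1), rotated])
      (simp add: linear_euclidean_expansion[OF assms(2), symmetric])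
qed

text \<open>By the chain rule the derivative is the derivative of f at g x, a composition covered by
  the induction hypothesis, applied to a direction that varies with x.\<close>

lemma Ck_on_compose:
  fixes g :: "'a::euclidean_space \<Rightarrow> 'b::euclidean_space" and f :: "'b \<Rightarrow> 'c::euclidean_space"
  assumes "open S" "g ` S \<subseteq> T" "Ck_on k T f" "Ck_on k S g"
  shows "Ck_on k S (\<lambda>x. f (g x))"
  using assms(2-4)
proof (induction k arbitrary: f g)
  case 0
  then show ?case
    by (simp add: continuous_on_compose2[of T f S g])
next
  case (Suc k)
  have f: "(f has_derivative frechet_derivative f (at (g x))) (at (g x))" if "x \<in> S" for x
    by (rule Ck_on_has_derivative[OF Suc.prems(2)]) (use that Suc.prems(1) in blast)
  show ?case
  proof (rule Ck_on_SucI[OF assms(1)])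
    show "((\<lambda>x. f (g x)) has_derivative
        (\<lambda>v. frechet_derivative f (at (g x)) (frechet_derivative g (at x) v))) (at x)"
      if "x \<in> S" for x
      by (rule has_derivative_compose[OF Ck_on_has_derivative[OF Suc.prems(3) that] f[OF that]])
    have "Ck_on k S g"
      using Suc.prems(3) by (rule Ck_on_SucD)
    moreover have "Ck_on k S (\<lambda>x. frechet_derivative f (at (g x)) v)" for v
      using Suc.IH[of g "\<lambda>y. frechet_derivative f (at y) v"] Suc.prems \<open>Ck_on k S g\<close> by simp
    ultimately show "Ck_on k S (\<lambda>x. frechet_derivative f (at (g x)) (frechet_derivative g (at x) v))"
      for v
      using Suc.prems(3) has_derivative_linear[OF f]
      by (simp add: Ck_on_apply_derivative[OF assms(1),
            of "\<lambda>x. frechet_derivative f (at (g x))" k "\<lambda>x. frechet_derivative g (at x) v"])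
  qed
qed

text \<open>The derivative of 1/f is built from 1/f and the derivative of f, so order k of 1/f gives
  order k + 1.\<close>

lemma Ck_on_inverse:
  fixes f :: "'a::euclidean_space \<Rightarrow> real"
  assumes "open S" "\<And>x. x \<in> S \<Longrightarrow> f x \<noteq> 0" "Ck_on k S f"
  shows "Ck_on k S (\<lambda>x. inverse (f x))"
  using assms(3)
proof (induction k)
  case 0
  then show ?case using assms(2) by (auto intro: continuous_on_inverse)
next
  case (Suc k)
  have "Ck_on k S (\<lambda>x. inverse (f x))"
    by (rule Suc.IH[OF Ck_on_SucD[OF Suc.prems]])
  then show ?case
    by (intro Ck_on_SucI[OF assms(1) Deriv.has_derivative_inverse[OF assms(2)
            Ck_on_has_derivative[OF Suc.prems]]] Ck_on_bounded_bilinear[OF assms(1) bounded_bilinear_mult]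
          Ck_on_bounded_linear[OF assms(1) bounded_linear_minus[OF bounded_linear_ident]])
      (use Suc.prems in auto)
qed

section \<open>From every finite order to smoothness\<close>

lemma smooth_on_subset: "smooth_on S f \<Longrightarrow> T \<subseteq> S \<Longrightarrow> smooth_on T f"
  unfolding smooth_on_def using Ck_on_subset by blast

lemma smooth_on_cong:
  "open S \<Longrightarrow> (\<And>x. x \<in> S \<Longrightarrow> f x = g x) \<Longrightarrow> smooth_on S f \<Longrightarrow> smooth_on S g"
  unfolding smooth_on_def using Ck_on_cong by blast

lemma smooth_on_local:
  "(\<And>x. x \<in> S \<Longrightarrow> \<exists>T. open T \<and> x \<in> T \<and> smooth_on T f) \<Longrightarrow> smooth_on S f"
  unfolding smooth_on_def by (metis Ck_on_local)

lemma smooth_on_const: "smooth_on S (\<lambda>x. c)"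
  unfolding smooth_on_def by (simp add: Ck_on_const)

lemma smooth_on_add:
  "open S \<Longrightarrow> smooth_on S f \<Longrightarrow> smooth_on S g \<Longrightarrow> smooth_on S (\<lambda>x. f x + g x)"
  unfolding smooth_on_def by (simp add: Ck_on_add)

lemma smooth_on_bounded_linear:
  fixes g :: "'a::euclidean_space \<Rightarrow> 'b::euclidean_space" and f :: "'b \<Rightarrow> 'c::euclidean_space"
  shows "open S \<Longrightarrow> bounded_linear f \<Longrightarrow> smooth_on S g \<Longrightarrow> smooth_on S (\<lambda>x. f (g x))"
  unfolding smooth_on_def by (simp add: Ck_on_bounded_linear)

lemma smooth_on_bounded_bilinear:
  fixes f :: "'a::euclidean_space \<Rightarrow> 'b::euclidean_space"
    and g :: "'a \<Rightarrow> 'c::euclidean_space" and times :: "'b \<Rightarrow> 'c \<Rightarrow> 'd::euclidean_space"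
  shows "open S \<Longrightarrow> bounded_bilinear times \<Longrightarrow> smooth_on S f \<Longrightarrow> smooth_on S g \<Longrightarrow>
    smooth_on S (\<lambda>x. times (f x) (g x))"
  unfolding smooth_on_def by (simp add: Ck_on_bounded_bilinear)

lemmas smooth_on_scaleR = smooth_on_bounded_bilinear[OF _ bounded_bilinear_scaleR]
lemmas smooth_on_mult = smooth_on_bounded_bilinear[OF _ bounded_bilinear_mult[where 'a=real]]

lemma smooth_on_diff:
  "open S \<Longrightarrow> smooth_on S f \<Longrightarrow> smooth_on S g \<Longrightarrow> smooth_on S (\<lambda>x. f x - g x)"
  using smooth_on_add[of S f "\<lambda>x. - g x"]
    smooth_on_bounded_linear[OF _ bounded_linear_minus[OF bounded_linear_ident], of S g] by simp

lemma smooth_on_id: "open S \<Longrightarrow> smooth_on S (\<lambda>x. x)"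
proof -
  assume S: "open S"
  have "Ck_on k S (\<lambda>x. x)" for k
    by (cases k) (auto intro!: Ck_on_SucI[OF S has_derivative_ident] Ck_on_const
        simp del: Ck_on.simps(2))
  then show ?thesis unfolding smooth_on_def by simp
qed

lemma smooth_on_compose:
  fixes g :: "'a::euclidean_space \<Rightarrow> 'b::euclidean_space" and f :: "'b \<Rightarrow> 'c::euclidean_space"
  shows "open S \<Longrightarrow> g ` S \<subseteq> T \<Longrightarrow> smooth_on T f \<Longrightarrow> smooth_on S g \<Longrightarrow> smooth_on S (\<lambda>x. f (g x))"
  unfolding smooth_on_def using Ck_on_compose[of S g T _ f] by simp

lemma smooth_on_inverse:
  fixes f :: "'a::euclidean_space \<Rightarrow> real"
  shows "open S \<Longrightarrow> (\<And>x. x \<in> S \<Longrightarrow> f x \<noteq> 0) \<Longrightarrow> smooth_on S f \<Longrightarrow> smooth_on S (\<lambda>x. inverse (f x))"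
  unfolding smooth_on_def by (simp add: Ck_on_inverse)

lemma smooth_on_divide:
  fixes f :: "'a::euclidean_space \<Rightarrow> real"
  shows "open S \<Longrightarrow> (\<And>x. x \<in> S \<Longrightarrow> g x \<noteq> 0) \<Longrightarrow> smooth_on S f \<Longrightarrow> smooth_on S g \<Longrightarrow>
    smooth_on S (\<lambda>x. f x / g x)"
  by (simp add: divide_inverse smooth_on_mult smooth_on_inverse)

lemma smooth_on_frechet_derivative:
  "smooth_on S f \<Longrightarrow> smooth_on S (\<lambda>x. frechet_derivative f (at x) v)"
  unfolding smooth_on_def using Ck_on.simps(2) by metis

lemma smooth_on_apply_derivative:
  fixes D :: "'a::euclidean_space \<Rightarrow> 'b::euclidean_space \<Rightarrow> 'c::euclidean_space"
  shows "open S \<Longrightarrow> (\<And>x. x \<in> S \<Longrightarrow> linear (D x)) \<Longrightarrow> (\<And>v. smooth_on S (\<lambda>x. D x v)) \<Longrightarrow>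
    smooth_on S w \<Longrightarrow> smooth_on S (\<lambda>x. D x (w x))"
  unfolding smooth_on_def by (simp add: Ck_on_apply_derivative)

lemma smooth_on_has_derivative:
  "smooth_on S f \<Longrightarrow> x \<in> S \<Longrightarrow> (f has_derivative frechet_derivative f (at x)) (at x)"
  unfolding smooth_on_def using Ck_on_has_derivative by blast

lemma smooth_on_imp_continuous_on: "smooth_on S f \<Longrightarrow> continuous_on S f"
  unfolding smooth_on_def using Ck_on.simps(1) by metis

section \<open>Symmetry of second derivatives\<close>

lemma second_difference_mean_value:
  fixes f :: "'a::euclidean_space \<Rightarrow> real"
  assumes f: "smooth_on S f" and s: "s > 0"
    and S: "\<And>a b. 0 \<le> a \<Longrightarrow> a \<le> s \<Longrightarrow> 0 \<le> b \<Longrightarrow> b \<le> s \<Longrightarrow> x + a *\<^sub>R u + b *\<^sub>R v \<in> S"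
  shows "\<exists>a b. 0 \<le> a \<and> a \<le> s \<and> 0 \<le> b \<and> b \<le> s \<and>
    f (x + s *\<^sub>R u + s *\<^sub>R v) - f (x + s *\<^sub>R u) - f (x + s *\<^sub>R v) + f x =
    s * s * frechet_derivative (\<lambda>y. frechet_derivative f (at y) u) (at (x + a *\<^sub>R u + b *\<^sub>R v)) v"
proof -
  define Df where "Df y = frechet_derivative f (at y)" for y
  define D2 where "D2 y = frechet_derivative (\<lambda>y. Df y u) (at y)" for y
  have Df: "(f has_derivative Df y) (at y)" if "y \<in> S" for y
    unfolding Df_def by (rule smooth_on_has_derivative[OF f that])
  have D2: "((\<lambda>y. Df y u) has_derivative D2 y) (at y)" if "y \<in> S" for y
    unfolding D2_def Df_def
    by (rule smooth_on_has_derivative[OF smooth_on_frechet_derivative[OF f] that])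
  have lin: "Df y (t *\<^sub>R w) = t * Df y w" if "y \<in> S" for y t w
    using linear_cmul[OF has_derivative_linear[OF Df[OF that]]] by simp
  have lin2: "D2 y (t *\<^sub>R w) = t * D2 y w" if "y \<in> S" for y t w
    using linear_cmul[OF has_derivative_linear[OF D2[OF that]]] by simp
  \<comment> \<open>The mean value theorem along u is applied to the increment of f by s v. What
    results is an increment of Df(.) u along v, to which it is applied once more.\<close>
  have "((\<lambda>a. f (x + a *\<^sub>R u + s *\<^sub>R v) - f (x + a *\<^sub>R u)) has_real_derivative
      Df (x + a *\<^sub>R u + s *\<^sub>R v) u - Df (x + a *\<^sub>R u) u) (at a)" if "0 \<le> a" "a \<le> s" for a
  proof -
    have in_S: "x + a *\<^sub>R u + s *\<^sub>R v \<in> S" "x + a *\<^sub>R u \<in> S"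
      using S[of a s] S[of a 0] that s by auto
    have "((\<lambda>a. x + a *\<^sub>R u + s *\<^sub>R v) has_derivative (\<lambda>a. a *\<^sub>R u)) (at a)"
      "((\<lambda>a. x + a *\<^sub>R u) has_derivative (\<lambda>a. a *\<^sub>R u)) (at a)"
      by (auto intro!: derivative_eq_intros)
    from has_derivative_diff[OF has_derivative_compose[OF this(1) Df[OF in_S(1)]]
        has_derivative_compose[OF this(2) Df[OF in_S(2)]]]
    show ?thesis
      unfolding has_field_derivative_def
      by (rule has_derivative_eq_rhs)
        (simp add: lin[OF in_S(1)] lin[OF in_S(2)] fun_eq_iff left_diff_distrib)
  qed
  then obtain a where a: "0 < a" "a < s"
      "(f (x + s *\<^sub>R u + s *\<^sub>R v) - f (x + s *\<^sub>R u)) - (f (x + 0 *\<^sub>R u + s *\<^sub>R v) - f (x + 0 *\<^sub>R u))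
        = (s - 0) * (Df (x + a *\<^sub>R u + s *\<^sub>R v) u - Df (x + a *\<^sub>R u) u)"
    using MVT2[OF s, of "\<lambda>a. f (x + a *\<^sub>R u + s *\<^sub>R v) - f (x + a *\<^sub>R u)"
        "\<lambda>a. Df (x + a *\<^sub>R u + s *\<^sub>R v) u - Df (x + a *\<^sub>R u) u"] by blast
  have "((\<lambda>b. Df (x + a *\<^sub>R u + b *\<^sub>R v) u) has_real_derivative D2 (x + a *\<^sub>R u + b *\<^sub>R v) v) (at b)"
    if "0 \<le> b" "b \<le> s" for b
  proof -
    have in_S: "x + a *\<^sub>R u + b *\<^sub>R v \<in> S"
      using S[of a b] that a by auto
    have "((\<lambda>b. x + a *\<^sub>R u + b *\<^sub>R v) has_derivative (\<lambda>b. b *\<^sub>R v)) (at b)"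
      by (auto intro!: derivative_eq_intros)
    from has_derivative_compose[OF this D2[OF in_S]]
    show ?thesis
      unfolding has_field_derivative_def
      by (rule has_derivative_eq_rhs) (simp add: lin2[OF in_S] fun_eq_iff mult.commute)
  qed
  then obtain b where b: "0 < b" "b < s"
      "Df (x + a *\<^sub>R u + s *\<^sub>R v) u - Df (x + a *\<^sub>R u + 0 *\<^sub>R v) u
        = (s - 0) * D2 (x + a *\<^sub>R u + b *\<^sub>R v) v"
    using MVT2[OF s, of "\<lambda>b. Df (x + a *\<^sub>R u + b *\<^sub>R v) u"
        "\<lambda>b. D2 (x + a *\<^sub>R u + b *\<^sub>R v) v"] by blast
  show ?thesis
    using a b unfolding D2_def Df_def
    by (intro exI[of _ a] exI[of _ b]) (auto simp: algebra_simps)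
qed

text \<open>The second difference over a parallelogram is symmetric in its sides. Read in both
  orders it equals s * s times either mixed derivative at nearby points, and continuity brings both
  back to x.\<close>

lemma second_derivative_symmetric:
  fixes f :: "'a::euclidean_space \<Rightarrow> real"
  assumes S: "open S" and f: "smooth_on S f" and x: "x \<in> S"
  shows "frechet_derivative (\<lambda>y. frechet_derivative f (at y) u) (at x) v =
    frechet_derivative (\<lambda>y. frechet_derivative f (at y) v) (at x) u"
proof -
  define A where "A y = frechet_derivative (\<lambda>y. frechet_derivative f (at y) u) (at y) v" for y
  define B where "B y = frechet_derivative (\<lambda>y. frechet_derivative f (at y) v) (at y) u" for y
  have "continuous_on S A" "continuous_on S B"
    unfolding A_def B_def
    using smooth_on_frechet_derivative[OF smooth_on_frechet_derivative[OF f]]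
    by (simp_all add: smooth_on_imp_continuous_on)
  then have AB: "isCont A x" "isCont B x"
    using x by (simp_all add: continuous_on_eq_continuous_at[OF S])
  have "\<bar>A x - B x\<bar> < e" if "e > 0" for e
  proof -
    obtain d1 where d1: "d1 > 0" "\<And>y. dist y x < d1 \<Longrightarrow> dist (A y) (A x) < e/2"
      using AB(1) half_gt_zero[OF \<open>e > 0\<close>] unfolding continuous_at_eps_delta by metis
    obtain d2 where d2: "d2 > 0" "\<And>y. dist y x < d2 \<Longrightarrow> dist (B y) (B x) < e/2"
      using AB(2) half_gt_zero[OF \<open>e > 0\<close>] unfolding continuous_at_eps_delta by metis
    obtain d3 where d3: "d3 > 0" "\<And>y. dist y x < d3 \<Longrightarrow> y \<in> S"
      using S x unfolding open_dist by blast
    define d where "d = min d1 (min d2 d3)"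
    have d: "d > 0" using d1 d2 d3 d_def by auto
    \<comment> \<open>Keeps the whole parallelogram within distance d of x; the summand 1 covers u =
      v = 0.\<close>
    define s where "s = d / (2 * (norm u + norm v + 1))"
    have s: "s > 0" unfolding s_def using d by (simp add: add_nonneg_pos)
    have small: "dist (x + a *\<^sub>R u + b *\<^sub>R v) x < d" if "0 \<le> a" "a \<le> s" "0 \<le> b" "b \<le> s" for a b
    proof -
      have "dist (x + a *\<^sub>R u + b *\<^sub>R v) x \<le> a * norm u + b * norm v"
        using norm_triangle_ineq[of "a *\<^sub>R u" "b *\<^sub>R v"] that by (simp add: dist_norm)
      also have "\<dots> \<le> s * norm u + s * norm v"
        using that by (intro add_mono mult_right_mono) auto
      also have "\<dots> < d"
      proof -
        have "s * (2 * (norm u + norm v + 1)) = d"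
          unfolding s_def by (simp add: add_nonneg_eq_0_iff)
        moreover have "s * norm u \<ge> 0" "s * norm v \<ge> 0" using s by auto
        ultimately show ?thesis using s by (simp only: distrib_left)
      qed
      finally show ?thesis .
    qed
    have in_S: "x + a *\<^sub>R u + b *\<^sub>R v \<in> S"
      if "0 \<le> a" "a \<le> s" "0 \<le> b" "b \<le> s" for a b
      using small[OF that] d3(2) d_def by auto
    have swap: "x + b *\<^sub>R v + a *\<^sub>R u = x + a *\<^sub>R u + b *\<^sub>R v" for a b
      by simp
    have in_S': "x + b *\<^sub>R v + a *\<^sub>R u \<in> S"
      if "0 \<le> b" "b \<le> s" "0 \<le> a" "a \<le> s" for a b
      unfolding swap by (rule in_S[OF that(3,4,1,2)])
    obtain a b where ab: "0 \<le> a" "a \<le> s" "0 \<le> b" "b \<le> s"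
      "f (x + s *\<^sub>R u + s *\<^sub>R v) - f (x + s *\<^sub>R u) - f (x + s *\<^sub>R v) + f x =
        s * s * A (x + a *\<^sub>R u + b *\<^sub>R v)"
      using second_difference_mean_value[OF f s in_S] unfolding A_def by blast
    obtain b' a' where ab': "0 \<le> a'" "a' \<le> s" "0 \<le> b'" "b' \<le> s"
      "f (x + s *\<^sub>R v + s *\<^sub>R u) - f (x + s *\<^sub>R v) - f (x + s *\<^sub>R u) + f x =
        s * s * B (x + b' *\<^sub>R v + a' *\<^sub>R u)"
      using second_difference_mean_value[OF f s in_S'] unfolding B_def by blast
    \<comment> \<open>Both mean value expressions represent the same second difference.\<close>
    have "s * s * A (x + a *\<^sub>R u + b *\<^sub>R v) = s * s * B (x + a' *\<^sub>R u + b' *\<^sub>R v)"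
      using ab(5) ab'(5) unfolding swap by linarith
    then have "A (x + a *\<^sub>R u + b *\<^sub>R v) = B (x + a' *\<^sub>R u + b' *\<^sub>R v)"
      using s by simp
    moreover have "dist (A (x + a *\<^sub>R u + b *\<^sub>R v)) (A x) < e/2"
      using d1(2) small[OF ab(1-4)] d_def by auto
    moreover have "dist (B (x + a' *\<^sub>R u + b' *\<^sub>R v)) (B x) < e/2"
      using d2(2) small[OF ab'(1-4)] d_def by auto
    ultimately show ?thesis unfolding dist_real_def by linarith
  qed
  then have "\<not> \<bar>A x - B x\<bar> > 0" by blast
  then show ?thesis unfolding A_def B_def by auto
qed

section \<open>Bump functions\<close>

text \<open>The power n is included so that the linear span of the family is closed under
  differentiation; n = 0 is the classical flat function exp(-1/t).\<close>

definition flat_at_0 :: "nat \<Rightarrow> real \<Rightarrow> real"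
  where "flat_at_0 n t = (if t > 0 then inverse t ^ n * exp (- inverse t) else 0)"

lemma flat_at_0_tendsto_0: "(flat_at_0 n \<longlongrightarrow> 0) (at 0)"
proof (rule filterlim_split_at)
  \<comment> \<open>Substituting 1/t, which tends to infinity, leaves the dominance of exp over
    powers.\<close>
  have "((\<lambda>t. inverse t ^ n / exp (inverse t)) \<longlongrightarrow> 0) (at_right (0::real))"
    by (rule filterlim_compose[OF tendsto_power_div_exp_0 filterlim_inverse_at_top_right])
  then show "(flat_at_0 n \<longlongrightarrow> 0) (at_right 0)"
    by (rule tendsto_cong[THEN iffD1, rotated])
      (auto simp: flat_at_0_def exp_minus divide_inverse eventually_at_right_less
        intro!: eventually_mono[OF eventually_at_right_less[of 0]])
  show "(flat_at_0 n \<longlongrightarrow> 0) (at_left 0)"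
    by (rule tendsto_eventually)
      (auto simp: flat_at_0_def eventually_at_filter intro!: always_eventually)
qed

lemma DERIV_flat_at_0:
  "(flat_at_0 n has_real_derivative flat_at_0 (n + 2) t - n * flat_at_0 (n + 1) t) (at t)"
proof (cases t "0::real" rule: linorder_cases)
  case less
  have "(flat_at_0 n has_real_derivative 0) (at t)"
    by (rule has_field_derivative_transform_within_open[of "\<lambda>_. 0" _ _ "{..<0}"])
      (use less in \<open>auto simp: flat_at_0_def\<close>)
  then show ?thesis using less by (simp add: flat_at_0_def)
next
  case equal
  \<comment> \<open>At 0 the difference quotient is the next member of the family, whose limit is
    0.\<close>
  have "(\<lambda>s. (flat_at_0 n (0 + s) - flat_at_0 n 0) / s) = flat_at_0 (Suc n)"
    by (auto simp: flat_at_0_def fun_eq_iff divide_inverse)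
  then show ?thesis
    using equal flat_at_0_tendsto_0[of "Suc n"]
    by (simp add: DERIV_def flat_at_0_def)
next
  case greater
  have "((\<lambda>t. inverse t ^ n * exp (- inverse t)) has_real_derivative
      real n * inverse t ^ (n - 1) * (- (inverse t * inverse t)) * exp (- inverse t) +
      exp (- inverse t) * (inverse t * inverse t) * inverse t ^ n) (at t)"
    using greater
    by (intro DERIV_mult DERIV_power[THEN DERIV_cong] DERIV_inverse[THEN DERIV_cong]
        DERIV_chain2[of exp, OF DERIV_exp] DERIV_minus[THEN DERIV_cong])
      (auto simp: power2_eq_square)
  also have "real n * inverse t ^ (n - 1) * (- (inverse t * inverse t)) * exp (- inverse t) +
      exp (- inverse t) * (inverse t * inverse t) * inverse t ^ n =
      flat_at_0 (n + 2) t - n * flat_at_0 (n + 1) t"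
    using greater by (cases n) (simp_all add: flat_at_0_def algebra_simps)
  finally have "((\<lambda>t. inverse t ^ n * exp (- inverse t)) has_real_derivative
      flat_at_0 (n + 2) t - n * flat_at_0 (n + 1) t) (at t)" .
  then show ?thesis
    by (rule has_field_derivative_transform_within_open[of _ _ _ "{0<..}"])
      (use greater in \<open>auto simp: flat_at_0_def\<close>)
qed

lemma smooth_flat_at_0: "smooth_on UNIV (flat_at_0 n)"
proof -
  have "Ck_on k UNIV (flat_at_0 n)" for k
  \<comment> \<open>The exponent stays free because the derivative involves n + 1 and n + 2.\<close>
  proof (induction k arbitrary: n)
    case 0
    show ?case
      using DERIV_flat_at_0 by (auto intro!: DERIV_continuous_on)
  next
    case (Suc k)
    have "Ck_on k UNIV (\<lambda>t. (flat_at_0 (n + 2) t + (- real n) * flat_at_0 (n + 1) t) * v)" for v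
      by (intro Ck_on_bounded_bilinear[OF _ bounded_bilinear_mult] Ck_on_add Ck_on_const Suc) auto
    then show ?case
      by (intro Ck_on_SucI[OF open_UNIV DERIV_flat_at_0[THEN has_field_derivative_imp_has_derivative]])
        simp
  qed
  then show ?thesis by (simp add: smooth_on_def)
qed

text \<open>One of t and 1 - t is always positive, so the denominator never vanishes.\<close>

definition smooth_step :: "real \<Rightarrow> real"
  where "smooth_step t = flat_at_0 0 t / (flat_at_0 0 t + flat_at_0 0 (1 - t))"

lemma smooth_step_values: "t \<le> 0 \<Longrightarrow> smooth_step t = 0" "t \<ge> 1 \<Longrightarrow> smooth_step t = 1"
  by (auto simp: smooth_step_def flat_at_0_def)

lemma smooth_smooth_step: "smooth_on UNIV smooth_step"
proof -
  have "flat_at_0 0 t + flat_at_0 0 (1 - t) \<noteq> 0" for t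
    by (auto simp: flat_at_0_def add_pos_pos intro!: less_imp_neq[THEN not_sym])
  moreover have "smooth_on UNIV (\<lambda>t::real. 1 - t)"
    by (intro smooth_on_diff smooth_on_const smooth_on_id) auto
  ultimately have "smooth_on UNIV (\<lambda>t. flat_at_0 0 t / (flat_at_0 0 t + flat_at_0 0 (1 - t)))"
    by (intro smooth_on_divide smooth_on_add smooth_flat_at_0
        smooth_on_compose[OF _ _ smooth_flat_at_0] smooth_on_const smooth_on_diff smooth_on_id) auto
  then show ?thesis by (simp add: smooth_step_def[abs_def])
qed

lemma bump_function_exists:
  fixes x :: "'a::euclidean_space"
  assumes "r > 0"
  obtains \<beta> :: "'a \<Rightarrow> real" where "smooth_on UNIV \<beta>" "\<And>y. y \<in> ball x r \<Longrightarrow> \<beta> y = 1"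
    "\<And>y. y \<notin> ball x (2 * r) \<Longrightarrow> \<beta> y = 0"
proof -
  \<comment> \<open>Squared distance keeps q smooth at the centre. On the ball of radius r it is at
    least 1; from distance 2 * r on it is at most 0 (even at most -2), which is where
    \<open>smooth_step\<close> is constant.\<close>
  define q where "q y = 2 - ((y - x) \<bullet> (y - x)) / r\<^sup>2" for y
  have "smooth_on UNIV (\<lambda>y. y - x)"
    by (intro smooth_on_diff smooth_on_id smooth_on_const) auto
  then have "smooth_on UNIV q"
    unfolding q_def[abs_def] using assms
    by (intro smooth_on_diff smooth_on_divide smooth_on_const smooth_on_id
        smooth_on_bounded_bilinear[OF _ bounded_bilinear_inner]) auto
  then have "smooth_on UNIV (\<lambda>y. smooth_step (q y))"
    by (intro smooth_on_compose[OF _ _ smooth_smooth_step]) auto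
  moreover have "smooth_step (q y) = 1" if "y \<in> ball x r" for y
  proof -
    have "(norm (y - x))\<^sup>2 \<le> r\<^sup>2"
      using that assms by (intro power_mono) (auto simp: dist_norm norm_minus_commute)
    then have "q y \<ge> 1"
      using assms by (simp add: q_def power2_norm_eq_inner[symmetric])
    then show ?thesis by (rule smooth_step_values)
  qed
  moreover have "smooth_step (q y) = 0" if "y \<notin> ball x (2 * r)" for y
  proof -
    have "(2 * r)\<^sup>2 \<le> (norm (y - x))\<^sup>2"
      using that assms by (intro power_mono) (auto simp: dist_norm norm_minus_commute)
    moreover have "(2 * r)\<^sup>2 = 4 * r\<^sup>2"
      by (simp add: power_mult_distrib)
    ultimately have "2 * r\<^sup>2 \<le> (norm (y - x))\<^sup>2"
      using zero_le_power2[of r] by linarith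
    then have "2 \<le> (norm (y - x))\<^sup>2 / r\<^sup>2"
      using assms by (simp add: pos_le_divide_eq)
    then have "q y \<le> 0"
      by (simp add: q_def power2_norm_eq_inner[symmetric])
    then show ?thesis by (rule smooth_step_values)
  qed
  ultimately show thesis by (rule that)
qed

section \<open>Charts, tangent vectors and covectors\<close>

lemma in_chart_apply:
  assumes "inj_on (snd c) (fst c)" "p \<in> fst c"
  shows "in_chart c f (snd c p) = f p"
  using assms by (simp add: in_chart_def)

definition transition_deriv :: "('a, 'm::finite) chart \<Rightarrow> ('a, 'm) chart \<Rightarrow> 'a \<Rightarrow> real ^ 'm \<Rightarrow> real ^ 'm"
  where "transition_deriv c c' p = frechet_derivative (transition c c') (at (snd c p))"

text \<open>Inverse to taking the component in \<open>c\<close>: a coordinate vector is spread to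
  all charts around the point by the Jacobians.\<close>

definition tangent_vector ::
  "('a, 'm::finite) chart set \<Rightarrow> ('a, 'm) chart \<Rightarrow> 'a \<Rightarrow> real ^ 'm \<Rightarrow> ('a, 'm) tvec"
  where "tangent_vector A c p w = (\<lambda>c'. if c' \<in> charts_at A p then transition_deriv c c' p w else 0)"

lemma has_derivative_frechetI: "(f has_derivative D) (at x) \<Longrightarrow> frechet_derivative f (at x) = D"
  using frechet_derivative_at by metis

locale smooth_atlas =
  fixes A :: "('a::{t2_space,second_countable_topology}, 'm::finite) chart set"
  assumes manifold: "smooth_manifold A"
begin

lemma chart_is_chart: "c \<in> A \<Longrightarrow> is_chart c"
  using manifold by (simp add: smooth_manifold_def)

lemma chart_open: "c \<in> A \<Longrightarrow> open (fst c)"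
  using chart_is_chart by (simp add: is_chart_def)

lemma chart_homeomorphism:
  "c \<in> A \<Longrightarrow> homeomorphism (fst c) (snd c ` fst c) (snd c) (inv_into (fst c) (snd c))"
  using chart_is_chart by (simp add: is_chart_def)

lemma chart_continuous: "c \<in> A \<Longrightarrow> continuous_on (fst c) (snd c)"
  "c \<in> A \<Longrightarrow> continuous_on (snd c ` fst c) (inv_into (fst c) (snd c))"
  using chart_homeomorphism by (auto simp: homeomorphism_def)

lemma chart_inj: "c \<in> A \<Longrightarrow> inj_on (snd c) (fst c)"
  using chart_homeomorphism by (metis homeomorphism_def inj_on_inverseI)

lemma chart_inverse: "c \<in> A \<Longrightarrow> p \<in> fst c \<Longrightarrow> inv_into (fst c) (snd c) (snd c p) = p"
  using chart_inj by simp

lemma in_chart_at: "c \<in> A \<Longrightarrow> p \<in> fst c \<Longrightarrow> in_chart c f (snd c p) = f p"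
  by (simp add: in_chart_apply chart_inj)

lemma chart_open_image:
  assumes "c \<in> A" "open W"
  shows "open (snd c ` (fst c \<inter> W))"
proof -
  have "openin (top_of_set (snd c ` fst c)) (snd c ` (fst c \<inter> W))"
    using homeomorphism_imp_open_map[OF chart_homeomorphism[OF assms(1)]] assms(2)
    by (metis inf_commute openin_open_Int)
  moreover have "open (snd c ` fst c)"
    using chart_is_chart[OF assms(1)] by (simp add: is_chart_def)
  ultimately show ?thesis
    by (metis openin_open_trans)
qed

lemma chart_open_range: "c \<in> A \<Longrightarrow> open (snd c ` fst c)"
  using chart_is_chart by (simp add: is_chart_def)

lemma chart_ex: "\<exists>c. c \<in> charts_at A p"
proof -
  have "p \<in> \<Union> (fst ` A)"
    using manifold by (simp add: smooth_manifold_def)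
  then show ?thesis by (auto simp: charts_at_def)
qed

section \<open>Jacobians of chart changes\<close>

lemma transition_at: "c \<in> A \<Longrightarrow> p \<in> fst c \<Longrightarrow> transition c c' (snd c p) = snd c' p"
  unfolding transition_def by (rule in_chart_at)

lemma transition_smooth:
  "c \<in> A \<Longrightarrow> c' \<in> A \<Longrightarrow> smooth_on (snd c ` (fst c \<inter> fst c')) (transition c c')"
  using manifold by (simp add: smooth_manifold_def compatible_def)

lemma transition_has_derivative:
  assumes "c \<in> charts_at A p" "c' \<in> charts_at A p"
  shows "(transition c c' has_derivative transition_deriv c c' p) (at (snd c p))"
  unfolding transition_deriv_def
  by (rule smooth_on_has_derivative[OF transition_smooth]) (use assms in \<open>auto simp: charts_at_def\<close>)

lemma transition_deriv_linear: "c \<in> charts_at A p \<Longrightarrow> c' \<in> charts_at A p \<Longrightarrow> linear (transition_deriv c c' p)"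
  by (rule has_derivative_linear[OF transition_has_derivative])

text \<open>Chain rule. The two local expressions of f agree only over the overlap of the charts,
  which is open, and this suffices for derivatives.\<close>

lemma in_chart_has_derivative_change:
  assumes "c \<in> charts_at A p" "c' \<in> charts_at A p"
    "(in_chart c' f has_derivative D) (at (snd c' p))"
  shows "(in_chart c f has_derivative (\<lambda>v. D (transition_deriv c c' p v))) (at (snd c p))"
proof -
  have "((\<lambda>x. in_chart c' f (transition c c' x)) has_derivative (\<lambda>v. D (transition_deriv c c' p v)))
      (at (snd c p))"
    using assms
    by (intro has_derivative_compose[OF transition_has_derivative])
      (auto simp: transition_at charts_at_def)
  then show ?thesis
    by (rule has_derivative_transform_within_open[of _ _ _ _ "snd c ` (fst c \<inter> fst c')"])
      (use assms in \<open>auto simp: charts_at_def in_chart_at transition_at intro!: chart_open_image chart_open\<close>)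
qed

text \<open>The chart change rule for derivatives, applied to the coordinate map of the third chart
  as the function.\<close>

lemma transition_deriv_compose:
  assumes "c \<in> charts_at A p" "c' \<in> charts_at A p" "c'' \<in> charts_at A p"
  shows "transition_deriv c' c'' p (transition_deriv c c' p v) = transition_deriv c c'' p v"
proof -
  have "(in_chart c (snd c'') has_derivative (\<lambda>v. transition_deriv c' c'' p (transition_deriv c c' p v))) (at (snd c p))"
    using transition_has_derivative[OF assms(2,3)] unfolding transition_def
    by (intro in_chart_has_derivative_change[OF assms(1,2)])
  then show ?thesis
    using has_derivative_unique[OF _ transition_has_derivative[OF assms(1,3)]]
    unfolding transition_def by (metis)
qed

lemma transition_deriv_same:
  assumes "c \<in> charts_at A p"
  shows "transition_deriv c c p v = v"
proof -
  have "((\<lambda>x. x) has_derivative (\<lambda>v. v)) (at (snd c p))"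
    by (rule has_derivative_ident)
  then have "(transition c c has_derivative (\<lambda>v. v)) (at (snd c p))"
    by (rule has_derivative_transform_within_open[of _ _ _ _ "snd c ` fst c"])
      (use assms in \<open>auto simp: charts_at_def transition_at chart_open_range\<close>)
  then show ?thesis
    using has_derivative_unique[OF _ transition_has_derivative[OF assms assms]] by metis
qed

section \<open>Tangent vectors as compatible families of components\<close>

lemma tangent_space_iff:
  "v \<in> tangent_space A p \<longleftrightarrow>
    (\<forall>c\<in>charts_at A p. \<forall>c'\<in>charts_at A p. v c' = transition_deriv c c' p (v c)) \<and>
    (\<forall>c. c \<notin> charts_at A p \<longrightarrow> v c = 0)"
  by (simp add: tangent_space_def transition_deriv_def)

lemma tangent_vector_in_tangent_space:
  "c \<in> charts_at A p \<Longrightarrow> tangent_vector A c p w \<in> tangent_space A p"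
  by (auto simp: tangent_space_iff tangent_vector_def transition_deriv_compose)

lemma tangent_vector_component: "c \<in> charts_at A p \<Longrightarrow> tangent_vector A c p w c = w"
  by (simp add: tangent_vector_def transition_deriv_same)

lemma tangent_change:
  "v \<in> tangent_space A p \<Longrightarrow> c \<in> charts_at A p \<Longrightarrow> c' \<in> charts_at A p \<Longrightarrow>
    v c' = transition_deriv c c' p (v c)"
  unfolding tangent_space_iff by blast

lemma tangent_outside: "v \<in> tangent_space A p \<Longrightarrow> c \<notin> charts_at A p \<Longrightarrow> v c = 0"
  unfolding tangent_space_iff by blast

text \<open>One component determines the others through the Jacobians, so identities of tangent
  vectors may be checked in a single chart.\<close>

lemma tangent_eqI:
  assumes "u \<in> tangent_space A p" "v \<in> tangent_space A p" "c \<in> charts_at A p" "u c = v c"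
  shows "u = v"
proof
  fix c'
  show "u c' = v c'"
    using assms tangent_change[OF assms(1,3)] tangent_change[OF assms(2,3)] tangent_outside
    by (cases "c' \<in> charts_at A p") metis+
qed

lemma tangent_space_comb:
  assumes "u \<in> tangent_space A p" "v \<in> tangent_space A p"
  shows "a *\<^sub>R u + b *\<^sub>R v \<in> tangent_space A p"
proof -
  have "a *\<^sub>R u c' + b *\<^sub>R v c' = transition_deriv c c' p (a *\<^sub>R u c + b *\<^sub>R v c)"
    if "c \<in> charts_at A p" "c' \<in> charts_at A p" for c c'
    unfolding tangent_change[OF assms(1) that] tangent_change[OF assms(2) that]
    by (simp add: linear_add[OF transition_deriv_linear[OF that]]
        linear_cmul[OF transition_deriv_linear[OF that]])
  moreover have "a *\<^sub>R u c + b *\<^sub>R v c = 0" if "c \<notin> charts_at A p" for c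
    using tangent_outside[OF assms(1) that] tangent_outside[OF assms(2) that] by simp
  ultimately show ?thesis
    unfolding tangent_space_iff plus_fun_apply scaleR_fun_def by blast
qed

lemma subspace_tangent_space: "subspace (tangent_space A p)"
proof -
  have "0 \<in> tangent_space A p"
    unfolding tangent_space_iff using linear_0[OF transition_deriv_linear] by auto
  then show ?thesis
    unfolding subspace_def
    using tangent_space_comb[of _ p _ 1 1] tangent_space_comb[of _ p 0 _ 0] by simp
qed

lemma coord_vector_eq:
  assumes "c \<in> charts_at A p"
  shows "coord_vector A c i p = tangent_vector A c p (axis i 1)"
  unfolding coord_vector_def
  by (intro the_equality conjI tangent_vector_in_tangent_space tangent_vector_component assms)
    (metis tangent_eqI tangent_vector_in_tangent_space tangent_vector_component assms)

text \<open>\<open>differential\<close> uses a chart fixed by choice. Differentiability in one chart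
  passes to all of them, and the chain rule matches the change of components of v, so any chart
  computes the same value.\<close>

lemma differential_eq:
  assumes "c \<in> charts_at A p" "v \<in> tangent_space A p" "c' \<in> charts_at A p"
    "(in_chart c' f has_derivative D) (at (snd c' p))"
  shows "differential A f p v = frechet_derivative (in_chart c f) (at (snd c p)) (v c)"
proof -
  define c0 where "c0 = (SOME c. c \<in> charts_at A p)"
  have c0: "c0 \<in> charts_at A p"
    unfolding c0_def using chart_ex by (rule someI_ex)
  have "frechet_derivative (in_chart c f) (at (snd c p)) (v c) = D (v c')"
    if "c \<in> charts_at A p" for c
    using has_derivative_frechetI[OF in_chart_has_derivative_change[OF that assms(3,4)]]
      tangent_change[OF assms(2) that assms(3)] by simp
  from this[OF c0] this[OF assms(1)] show ?thesis
    using assms(2) by (simp add: differential_def Let_def c0_def)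
qed

section \<open>Covectors and their pairing with tangent vectors\<close>

lemma cotangentI:
  assumes "\<And>u v a b. u \<in> tangent_space A p \<Longrightarrow> v \<in> tangent_space A p \<Longrightarrow>
      \<alpha> (a *\<^sub>R u + b *\<^sub>R v) = a * \<alpha> u + b * \<alpha> v"
    "\<And>v. v \<notin> tangent_space A p \<Longrightarrow> \<alpha> v = 0"
  shows "\<alpha> \<in> cotangent_space A p"
  using assms by (auto simp: cotangent_space_def dual_space_def)

lemma cotangent_linear:
  assumes "\<alpha> \<in> cotangent_space A p" "u \<in> tangent_space A p" "v \<in> tangent_space A p"
  shows "\<alpha> (a *\<^sub>R u + b *\<^sub>R v) = a * \<alpha> u + b * \<alpha> v"
  using assms by (auto simp: cotangent_space_def dual_space_def)

lemma cotangent_diff_scaleR: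
  assumes "\<alpha> \<in> cotangent_space A p" "u \<in> tangent_space A p" "v \<in> tangent_space A p"
  shows "\<alpha> (a *\<^sub>R u - b *\<^sub>R v) = a * \<alpha> u - b * \<alpha> v"
  using cotangent_linear[OF assms, of a "- b"] by simp

lemma cotangent_zero: "\<alpha> \<in> cotangent_space A p \<Longrightarrow> \<alpha> 0 = 0"
  using cotangent_linear[of \<alpha> p 0 0 0 0] subspace_0[OF subspace_tangent_space] by simp

lemma cotangent_comb:
  assumes "\<alpha> \<in> cotangent_space A p" "\<beta> \<in> cotangent_space A p"
  shows "(\<lambda>v. a * \<alpha> v + b * \<beta> v) \<in> cotangent_space A p"
  using assms by (auto simp: cotangent_space_def dual_space_def algebra_simps)

lemma chart_covector:
  assumes "c \<in> charts_at A p" "linear l"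
  shows "(\<lambda>v. if v \<in> tangent_space A p then l (v c) else 0) \<in> cotangent_space A p"
proof (rule cotangentI)
  fix u v a b assume uv: "u \<in> tangent_space A p" "v \<in> tangent_space A p"
  have "(a *\<^sub>R u + b *\<^sub>R v) c = a *\<^sub>R u c + b *\<^sub>R v c"
    by (simp add: scaleR_fun_def)
  then show "(if a *\<^sub>R u + b *\<^sub>R v \<in> tangent_space A p then l ((a *\<^sub>R u + b *\<^sub>R v) c) else 0) =
      a * (if u \<in> tangent_space A p then l (u c) else 0) +
      b * (if v \<in> tangent_space A p then l (v c) else 0)"
    using uv tangent_space_comb[OF uv] by (simp add: linear_add[OF assms(2)] linear_cmul[OF assms(2)])
qed simp

lemma differential_cotangent:
  assumes "c \<in> charts_at A p" "(in_chart c f has_derivative D) (at (snd c p))"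
  shows "differential A f p \<in> cotangent_space A p"
proof -
  have "differential A f p = (\<lambda>v. if v \<in> tangent_space A p then D (v c) else 0)"
    using differential_eq[OF assms(1) _ assms] has_derivative_frechetI[OF assms(2)]
    by (auto simp: fun_eq_iff differential_def)
  then show ?thesis
    using chart_covector[OF assms(1) has_derivative_linear[OF assms(2)]] by simp
qed

lemma in_chart_coordinate_has_derivative:
  assumes "c \<in> charts_at A p"
  shows "(in_chart c (\<lambda>q. snd c q $ i) has_derivative (\<lambda>v. v $ i)) (at (snd c p))"
proof (rule has_derivative_transform_within_open)
  show "((\<lambda>x. x $ i) has_derivative (\<lambda>v. v $ i)) (at (snd c p))"
    by (rule bounded_linear_imp_has_derivative) (rule bounded_linear_vec_nth)
  show "open (snd c ` fst c)" "snd c p \<in> snd c ` fst c"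
    using assms chart_open_range by (auto simp: charts_at_def)
  show "\<And>x. x \<in> snd c ` fst c \<Longrightarrow> x $ i = in_chart c (\<lambda>q. snd c q $ i) x"
    using assms by (auto simp: charts_at_def in_chart_at)
qed

lemma coord_covector_apply:
  assumes "c \<in> charts_at A p" "v \<in> tangent_space A p"
  shows "coord_covector A c i p v = v c $ i"
  unfolding coord_covector_def
  using differential_eq[OF assms assms(1) in_chart_coordinate_has_derivative[OF assms(1)]]
    has_derivative_frechetI[OF in_chart_coordinate_has_derivative[OF assms(1)]] by simp

lemma coord_covector_cotangent:
  "c \<in> charts_at A p \<Longrightarrow> coord_covector A c i p \<in> cotangent_space A p"
  unfolding coord_covector_def by (rule differential_cotangent[OF _ in_chart_coordinate_has_derivative])

text \<open>The coordinate covectors of one chart already recover all components there. This is the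
  uniqueness behind the definite description in \<open>sharp\<close>.\<close>

lemma cotangent_separates:
  assumes "u \<in> tangent_space A p" "v \<in> tangent_space A p"
    "\<And>\<beta>. \<beta> \<in> cotangent_space A p \<Longrightarrow> \<beta> u = \<beta> v"
  shows "u = v"
proof -
  obtain c where c: "c \<in> charts_at A p" using chart_ex by blast
  have "u c $ i = v c $ i" for i
    using assms(3)[OF coord_covector_cotangent[OF c]] assms c by (simp add: coord_covector_apply)
  then show ?thesis
    using tangent_eqI[OF assms(1,2) c] by (simp add: vec_eq_iff)
qed

lemma cotangent_nonzero_ex:
  assumes "v \<in> tangent_space A p" "v \<noteq> 0"
  obtains \<beta> where "\<beta> \<in> cotangent_space A p" "\<beta> v = 1"
proof -
  have "\<not> (\<forall>\<beta>\<in>cotangent_space A p. \<beta> v = \<beta> 0)"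
    using cotangent_separates[OF assms(1) subspace_0[OF subspace_tangent_space]] assms(2) by blast
  then obtain \<beta> where "\<beta> \<in> cotangent_space A p" "\<beta> v \<noteq> \<beta> 0"
    by blast
  then have \<beta>: "\<beta> \<in> cotangent_space A p" "\<beta> v \<noteq> 0"
    using cotangent_zero[of \<beta> p] by auto
  show thesis
    by (rule that[OF cotangent_comb[OF \<beta>(1) \<beta>(1), of "1 / \<beta> v" 0]]) (use \<beta> in simp)
qed

section \<open>Decomposable bivectors\<close>

lemma sharp_wedge:
  assumes "X p \<in> tangent_space A p" "Y p \<in> tangent_space A p" "\<alpha> \<in> cotangent_space A p"
  shows "sharp A (wedge A Y X) p \<alpha> = \<alpha> (Y p) *\<^sub>R X p - \<alpha> (X p) *\<^sub>R Y p"
  unfolding sharp_def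
proof (rule the_equality)
  let ?v = "\<alpha> (Y p) *\<^sub>R X p - \<alpha> (X p) *\<^sub>R Y p"
  have v: "?v \<in> tangent_space A p"
    using assms by (intro subspace_diff subspace_scale subspace_tangent_space)
  have eq: "\<beta> ?v = wedge A Y X p \<alpha> \<beta>" if "\<beta> \<in> cotangent_space A p" for \<beta>
    using cotangent_diff_scaleR[OF that assms(1,2)] that assms by (simp add: wedge_def)
  then show "?v \<in> tangent_space A p \<and> (\<forall>\<beta>\<in>cotangent_space A p. \<beta> ?v = wedge A Y X p \<alpha> \<beta>)"
    using v by simp
  show "w = ?v" if "w \<in> tangent_space A p \<and> (\<forall>\<beta>\<in>cotangent_space A p. \<beta> w = wedge A Y X p \<alpha> \<beta>)" for w
    using that v eq by (intro cotangent_separates[of w p ?v]) auto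
qed

lemma wedge_bivector:
  assumes "X p \<in> tangent_space A p" "Y p \<in> tangent_space A p"
  shows "wedge A Y X p \<in> bivectors A p"
proof -
  have "a *\<^sub>R u + b *\<^sub>R v \<in> cotangent_space A p"
    if "u \<in> cotangent_space A p" "v \<in> cotangent_space A p" for u v a b
  proof -
    have "a *\<^sub>R u + b *\<^sub>R v = (\<lambda>x. a * u x + b * v x)"
      by (simp add: fun_eq_iff scaleR_fun_def)
    then show ?thesis using cotangent_comb[OF that] by simp
  qed
  moreover have "(a *\<^sub>R u + b *\<^sub>R v) x = a * u x + b * v x" for a b x and u v :: "('a, 'm) tvec \<Rightarrow> real"
    by (simp add: scaleR_fun_def)
  ultimately show ?thesis
    by (auto simp: bivectors_def wedge_def dual_space_def fun_eq_iff algebra_simps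
        simp del: plus_fun_apply)
qed

lemma bivector_comp_wedge:
  assumes "X p \<in> tangent_space A p" "Y p \<in> tangent_space A p" "c \<in> charts_at A p"
  shows "bivector_comp A (wedge A Y X) c i j p = Y p c $ i * X p c $ j - X p c $ i * Y p c $ j"
  using assms by (simp add: bivector_comp_def wedge_def coord_covector_cotangent coord_covector_apply)

end

section \<open>Curves and the tangent spaces of leaves\<close>

context smooth_atlas
begin

lemma smooth_function_has_derivative:
  assumes "smooth_function A f" "c \<in> charts_at A p"
  shows "(in_chart c f has_derivative frechet_derivative (in_chart c f) (at (snd c p))) (at (snd c p))"
proof (rule smooth_on_has_derivative)
  show "smooth_on (snd c ` fst c) (in_chart c f)" "snd c p \<in> snd c ` fst c"
    using assms by (auto simp: smooth_function_def charts_at_def)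
qed

lemma differential_smooth_function_cotangent:
  assumes "smooth_function A f"
  shows "differential A f p \<in> cotangent_space A p"
proof -
  obtain c where "c \<in> charts_at A p" using chart_ex by blast
  from differential_cotangent[OF this smooth_function_has_derivative[OF assms this]] show ?thesis .
qed

lemma differential_smooth_function_eq:
  assumes "smooth_function A f" "c \<in> charts_at A p" "v \<in> tangent_space A p"
  shows "differential A f p v = frechet_derivative (in_chart c f) (at (snd c p)) (v c)"
  by (rule differential_eq[OF assms(2,3,2) smooth_function_has_derivative[OF assms(1,2)]])

section \<open>Velocities of curves\<close>

lemma open_curve_preimage:
  assumes "open J" "continuous_on J \<gamma>" "c \<in> A"
  shows "open (J \<inter> \<gamma> -` fst c)"
  using continuous_open_preimage[OF assms(2,1) chart_open[OF assms(3)]] by (simp add: vimage_def Int_def)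

lemma smooth_curve_has_velocity:
  assumes "smooth_curve A J \<gamma>" "open J" "t \<in> J" "c \<in> charts_at A (\<gamma> t)"
  shows "((\<lambda>s. snd c (\<gamma> s)) has_vector_derivative velocity A \<gamma> t c) (at t)"
proof -
  have "smooth_on (J \<inter> \<gamma> -` fst c) (snd c \<circ> \<gamma>)" "t \<in> J \<inter> \<gamma> -` fst c"
    using assms by (auto simp: smooth_curve_def charts_at_def)
  from smooth_on_has_derivative[OF this] have "(snd c \<circ> \<gamma>) differentiable (at t)"
    by (rule differentiableI)
  then show ?thesis
    using assms(4) by (simp add: vector_derivative_works velocity_def o_def)
qed

text \<open>Chain rule along a curve. With the coordinate map of a second chart as f it also yields
  the transformation law of velocities.\<close>

lemma in_chart_curve_has_derivative:
  assumes "smooth_curve A J \<gamma>" "open J" "t \<in> J" "c \<in> charts_at A (\<gamma> t)"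
    "(in_chart c f has_derivative D) (at (snd c (\<gamma> t)))"
  shows "((\<lambda>s. f (\<gamma> s)) has_vector_derivative D (velocity A \<gamma> t c)) (at t)"
proof -
  have "((\<lambda>s. in_chart c f (snd c (\<gamma> s))) has_vector_derivative D (velocity A \<gamma> t c)) (at t)"
    using vector_derivative_diff_chain_within[OF smooth_curve_has_velocity[OF assms(1-4)]
        has_derivative_at_withinI[OF assms(5)]] by (simp add: o_def)
  then show ?thesis
    by (rule has_vector_derivative_transform_within_open[of _ _ _ "J \<inter> \<gamma> -` fst c"])
      (use assms(1-4) in \<open>auto simp: smooth_curve_def charts_at_def in_chart_at open_curve_preimage\<close>)
qed

lemma velocity_in_tangent_space:
  assumes "smooth_curve A J \<gamma>" "open J" "t \<in> J"
  shows "velocity A \<gamma> t \<in> tangent_space A (\<gamma> t)"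
  unfolding tangent_space_iff
proof (intro conjI ballI allI impI)
  fix c c' assume c: "c \<in> charts_at A (\<gamma> t)" "c' \<in> charts_at A (\<gamma> t)"
  show "velocity A \<gamma> t c' = transition_deriv c c' (\<gamma> t) (velocity A \<gamma> t c)"
    using vector_derivative_unique_at[OF smooth_curve_has_velocity[OF assms c(2)]
        in_chart_curve_has_derivative[OF assms c(1), of "snd c'"]]
      transition_has_derivative[OF c] by (simp add: transition_def)
qed (simp add: velocity_def)

lemma tangent_to_in_tangent_space: "v \<in> tangent_to A N p \<Longrightarrow> v \<in> tangent_space A p"
  unfolding tangent_to_def using velocity_in_tangent_space[of "{-e<..<e}" _ 0 for e] by fastforce

text \<open>Along a curve in the level set f is constant, while its derivative at 0 is the
  differential applied to the velocity.\<close>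

lemma differential_tangent_to_level_set:
  assumes "smooth_function A f" "v \<in> tangent_to A (f -` {r}) p"
  shows "differential A f p v = 0"
proof -
  obtain \<gamma> e where v: "v = velocity A \<gamma> 0" "e > 0" "smooth_curve A {-e<..<e} \<gamma>"
      "\<gamma> ` {-e<..<e} \<subseteq> f -` {r}" "\<gamma> 0 = p"
    using assms(2) by (auto simp: tangent_to_def)
  obtain c where c: "c \<in> charts_at A (\<gamma> 0)" using chart_ex by blast
  have 0: "0 \<in> {-e<..<e}" using v by simp
  have D: "((\<lambda>s. f (\<gamma> s)) has_vector_derivative differential A f p v) (at 0)"
    using in_chart_curve_has_derivative[OF v(3) _ 0 c smooth_function_has_derivative[OF assms(1) c]]
      differential_smooth_function_eq[OF assms(1) c velocity_in_tangent_space[OF v(3) _ 0]] v by simp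
  have r: "f (\<gamma> s) = r" if "s \<in> {-e<..<e}" for s
    using v(4) that by blast
  have "((\<lambda>s. r) has_vector_derivative 0) (at 0)"
    by (rule has_vector_derivative_const)
  then have "((\<lambda>s. f (\<gamma> s)) has_vector_derivative 0) (at 0)"
    by (rule has_vector_derivative_transform_within_open[of _ _ _ "{-e<..<e}"]) (use r 0 in auto)
  with D show ?thesis by (rule vector_derivative_unique_at)
qed

section \<open>Plaques and the tangent spaces of leaves\<close>

lemma plaque_of_leaf:
  assumes "foliated_chart A F I c" "L \<in> F" "p \<in> L" "p \<in> fst c"
  shows "{q \<in> fst c. \<forall>i\<in>- I. snd c q $ i = snd c p $ i} \<in> path_components_of (top_of_set (L \<inter> fst c))"
proof -
  \<comment> \<open>The path components cover the leaf inside the chart. A foliated chart makes each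
    of them a level set of the transverse coordinates, so the one containing p is the level set
    through p.\<close>
  have "p \<in> \<Union> (path_components_of (top_of_set (L \<inter> fst c)))"
    using assms by (simp add: Union_path_components_of)
  then obtain C where C: "C \<in> path_components_of (top_of_set (L \<inter> fst c))" "p \<in> C"
    by blast
  then have "C \<in> leaves_on F (fst c)"
    using assms(2) by (auto simp: leaves_on_def)
  then obtain p' where p': "C = {q \<in> fst c. \<forall>i\<in>- I. snd c q $ i = snd c p' $ i}"
    using assms(1) by (auto simp: foliated_chart_def)
  have "C = {q \<in> fst c. \<forall>i\<in>- I. snd c q $ i = snd c p $ i}"
    using C(2) unfolding p' by auto
  then show ?thesis using C by simp
qed

text \<open>A short piece of a curve in a leaf is path connected, so it stays in one plaque. There
  the transverse coordinates are constant and the velocity has no transverse components.\<close>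

lemma foliation_tangent_subset:
  assumes c: "foliated_chart A F I c" "p \<in> fst c" and v: "v \<in> foliation_tangent A F p"
  shows "v \<in> tangent_space A p" "i \<notin> I \<Longrightarrow> v c $ i = 0"
proof -
  obtain L where L: "L \<in> F" "p \<in> L" "v \<in> tangent_to A L p"
    using v by (auto simp: foliation_tangent_def)
  show "v \<in> tangent_space A p" by (rule tangent_to_in_tangent_space[OF L(3)])
  assume i: "i \<notin> I"
  obtain \<gamma> e where \<gamma>: "v = velocity A \<gamma> 0" "e > 0" "smooth_curve A {-e<..<e} \<gamma>"
      "\<gamma> ` {-e<..<e} \<subseteq> L" "\<gamma> 0 = p"
    using L(3) by (auto simp: tangent_to_def)
  have cA: "c \<in> A" using c by (simp add: foliated_chart_def)
  then have c_at: "c \<in> charts_at A (\<gamma> 0)" using c \<gamma> by (simp add: charts_at_def)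
  have cont: "continuous_on {-e<..<e} \<gamma>" using \<gamma> by (simp add: smooth_curve_def)
  have "open ({-e<..<e} \<inter> \<gamma> -` fst c)" "0 \<in> {-e<..<e} \<inter> \<gamma> -` fst c"
    using open_curve_preimage[OF _ cont cA] \<gamma> c by auto
  \<comment> \<open>An interval of times is taken because its image must be path connected; the
    whole preimage of the chart may be disconnected.\<close>
  then obtain d where d: "d > 0" "ball 0 d \<subseteq> {-e<..<e} \<inter> \<gamma> -` fst c"
    using open_contains_ball by blast
  have ball: "(0::real) \<in> ball 0 d" using d by simp
  let ?P = "{q \<in> fst c. \<forall>i\<in>- I. snd c q $ i = snd c p $ i}"
  have "path_connected (\<gamma> ` ball 0 d)"
    using d(2) by (intro path_connected_continuous_image continuous_on_subset[OF cont]
        convex_imp_path_connected) auto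
  then have "path_connectedin (top_of_set (L \<inter> fst c)) (\<gamma> ` ball 0 d)"
    using d(2) \<gamma>(4) by (auto simp: path_connectedin_subtopology)
  moreover have "\<not> disjnt ?P (\<gamma> ` ball 0 d)"
    using \<gamma>(5) c(2) ball by (auto simp: disjnt_def)
  ultimately have "\<gamma> ` ball 0 d \<subseteq> ?P"
    by (intro path_components_of_maximal[OF plaque_of_leaf[OF c(1) L(1,2) c(2)]])
  then have const: "snd c p $ i = snd c (\<gamma> s) $ i" if "s \<in> ball 0 d" for s
  proof -
    have "\<gamma> s \<in> ?P" using \<open>\<gamma> ` ball 0 d \<subseteq> ?P\<close> that by blast
    then show ?thesis using i by simp
  qed
  have "((\<lambda>s. snd c p $ i) has_vector_derivative 0) (at 0)"
    by (rule has_vector_derivative_const)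
  then have "((\<lambda>s. snd c (\<gamma> s) $ i) has_vector_derivative 0) (at 0)"
    by (rule has_vector_derivative_transform_within_open[OF _ open_ball ball const])
  moreover have "((\<lambda>s. snd c (\<gamma> s) $ i) has_vector_derivative v c $ i) (at 0)"
    using bounded_linear.has_vector_derivative[OF bounded_linear_vec_nth
        smooth_curve_has_velocity[OF \<gamma>(3) _ _ c_at]] \<gamma> by simp
  ultimately show "v c $ i = 0"
    using vector_derivative_unique_at by blast
qed

text \<open>The coordinate line through p in the direction \<open>v c\<close> keeps the transverse
  coordinates fixed. It therefore runs in a plaque, hence in a leaf, and has velocity v.\<close>

lemma foliation_tangent_supset:
  assumes c: "foliated_chart A F I c" "p \<in> fst c"
    and v: "v \<in> tangent_space A p" "\<And>i. i \<notin> I \<Longrightarrow> v c $ i = 0"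
  shows "v \<in> foliation_tangent A F p"
proof -
  have cA: "c \<in> A" using c by (simp add: foliated_chart_def)
  define \<phi> where "\<phi> = inv_into (fst c) (snd c)"
  define \<gamma> where "\<gamma> t = \<phi> (snd c p + t *\<^sub>R v c)" for t
  obtain d where d: "d > 0" "ball (snd c p) d \<subseteq> snd c ` fst c"
    using chart_open_range[OF cA] c(2) by (meson imageI open_contains_ball)
  \<comment> \<open>Keeps the coordinate line inside the ball of radius d; the summand 1 covers
    \<open>v c = 0\<close>.\<close>
  define e where "e = d / (norm (v c) + 1)"
  have e: "e > 0" unfolding e_def using d by (simp add: add_nonneg_pos)
  let ?J = "{-e<..<e}"
  have in_range: "snd c p + t *\<^sub>R v c \<in> snd c ` fst c" if "t \<in> ?J" for t
  proof -
    have "\<bar>t\<bar> * norm (v c) \<le> \<bar>t\<bar> * (norm (v c) + 1)"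
      by (intro mult_left_mono) auto
    also have "\<dots> < e * (norm (v c) + 1)"
      using that by (intro mult_strict_right_mono) (auto simp: add_nonneg_pos)
    also have "\<dots> = d"
      unfolding e_def using add_nonneg_pos[OF norm_ge_zero[of "v c"] zero_less_one] by simp
    finally have "snd c p + t *\<^sub>R v c \<in> ball (snd c p) d"
      by (simp add: dist_norm)
    then show ?thesis using d by blast
  qed
  have \<gamma>_in: "\<gamma> t \<in> fst c" "snd c (\<gamma> t) = snd c p + t *\<^sub>R v c" if "t \<in> ?J" for t
    using in_range[OF that] unfolding \<gamma>_def \<phi>_def
    by (auto intro: inv_into_into f_inv_into_f)
  have \<gamma>0: "\<gamma> 0 = p"
    unfolding \<gamma>_def \<phi>_def using chart_inverse[OF cA c(2)] by simp
  have cont: "continuous_on ?J \<gamma>"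
    unfolding \<gamma>_def \<phi>_def
    by (rule continuous_on_compose2[OF chart_continuous(2)[OF cA]])
      (use in_range in \<open>auto intro!: continuous_intros\<close>)
  \<comment> \<open>In any other chart the curve is a transition map after an affine map.\<close>
  have "smooth_on (?J \<inter> \<gamma> -` fst c') (snd c' \<circ> \<gamma>)" if c': "c' \<in> A" for c'
  proof -
    have op: "open (?J \<inter> \<gamma> -` fst c')"
      by (rule open_curve_preimage[OF _ cont c']) simp
    have "smooth_on (?J \<inter> \<gamma> -` fst c') (\<lambda>t. snd c p + t *\<^sub>R v c)"
      by (intro smooth_on_add smooth_on_scaleR smooth_on_const smooth_on_id op)
    moreover have "snd c p + t *\<^sub>R v c \<in> snd c ` (fst c \<inter> fst c')" if "t \<in> ?J \<inter> \<gamma> -` fst c'" for t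
      using \<gamma>_in[of t] that by (metis IntD1 IntD2 IntI image_eqI vimageD)
    ultimately have "smooth_on (?J \<inter> \<gamma> -` fst c') (\<lambda>t. transition c c' (snd c p + t *\<^sub>R v c))"
      by (intro smooth_on_compose[OF op _ transition_smooth[OF cA c']]) auto
    moreover have "(\<lambda>t. transition c c' (snd c p + t *\<^sub>R v c)) = snd c' \<circ> \<gamma>"
      by (simp add: fun_eq_iff transition_def in_chart_def \<gamma>_def \<phi>_def)
    ultimately show ?thesis by simp
  qed
  then have curve: "smooth_curve A ?J \<gamma>"
    using cont by (simp add: smooth_curve_def)
  have zero: "0 \<in> ?J" using e by simp
  have c_at: "c \<in> charts_at A (\<gamma> 0)" using cA c \<gamma>0 by (simp add: charts_at_def)
  have "((\<lambda>t. snd c p + t *\<^sub>R v c) has_vector_derivative v c) (at 0)"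
    by (auto intro!: derivative_eq_intros)
  then have "((\<lambda>t. snd c (\<gamma> t)) has_vector_derivative v c) (at 0)"
    by (rule has_vector_derivative_transform_within_open[OF _ _ zero]) (auto simp: \<gamma>_in)
  then have "velocity A \<gamma> 0 c = v c"
    using smooth_curve_has_velocity[OF curve _ zero c_at] vector_derivative_unique_at by auto
  then have vel: "velocity A \<gamma> 0 = v"
    using velocity_in_tangent_space[OF curve _ zero] v(1) c_at \<gamma>0
    by (intro tangent_eqI[of _ p _ c]) auto
  let ?P = "{q \<in> fst c. \<forall>i\<in>- I. snd c q $ i = snd c p $ i}"
  have "?P \<in> leaves_on F (fst c)"
    using c by (auto simp: foliated_chart_def)
  then obtain L where L: "L \<in> F" "?P \<in> path_components_of (top_of_set (L \<inter> fst c))"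
    by (auto simp: leaves_on_def)
  then have P_L: "?P \<subseteq> L"
    using Union_path_components_of[of "top_of_set (L \<inter> fst c)"] by auto
  have "\<gamma> t \<in> ?P" if "t \<in> ?J" for t
    using \<gamma>_in[OF that] v(2) by auto
  then have "\<gamma> ` ?J \<subseteq> L" "p \<in> L"
    using P_L c(2) by auto
  then have "v \<in> tangent_to A L p"
    unfolding tangent_to_def using vel e curve \<gamma>0 by blast
  then show ?thesis
    using L \<open>p \<in> L\<close> by (auto simp: foliation_tangent_def)
qed

text \<open>Turns leaf geometry into linear equations in one chart. In particular the velocities of
  curves in a leaf form a linear space, which their definition does not show.\<close>

lemma foliation_tangent_iff:
  assumes "foliated_chart A F I c" "p \<in> fst c"
  shows "v \<in> foliation_tangent A F p \<longleftrightarrow> v \<in> tangent_space A p \<and> (\<forall>i. i \<notin> I \<longrightarrow> v c $ i = 0)"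
  using foliation_tangent_subset[OF assms] foliation_tangent_supset[OF assms] by blast

end

section \<open>The Schouten bracket of a decomposable bivector field\<close>

text \<open>Product rule for a derivative applied to a varying direction: one term from moving the
  base point with the direction frozen, one from moving the direction.\<close>

lemma has_derivative_apply_derivative:
  fixes f :: "'a::euclidean_space \<Rightarrow> real" and u :: "'a \<Rightarrow> 'a"
  assumes f: "smooth_on U f" and z: "z \<in> U" and u: "(u has_derivative u') (at z)" and U: "open U"
  shows "((\<lambda>w. frechet_derivative f (at w) (u w)) has_derivative
    (\<lambda>v. frechet_derivative (\<lambda>w. frechet_derivative f (at w) (u z)) (at z) v +
      frechet_derivative f (at z) (u' v))) (at z)"
proof -
  define Df where "Df w = frechet_derivative f (at w)" for w
  have lin: "linear (Df w)" if "w \<in> U" for w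
    unfolding Df_def by (rule has_derivative_linear[OF smooth_on_has_derivative[OF f that]])
  have D2: "((\<lambda>w. Df w v) has_derivative frechet_derivative (\<lambda>w. Df w v) (at z)) (at z)" for v
    unfolding Df_def
    by (rule smooth_on_has_derivative[OF smooth_on_frechet_derivative[OF f] z])
  \<comment> \<open>The expansion with coefficients frozen at z identifies the sum of second
    derivatives as the derivative of \<open>\<lambda>w. Df w (u z)\<close>.\<close>
  have const: "((\<lambda>w. \<Sum>b\<in>Basis. (u z \<bullet> b) *\<^sub>R Df w b) has_derivative
      (\<lambda>v. \<Sum>b\<in>Basis. (u z \<bullet> b) *\<^sub>R frechet_derivative (\<lambda>w. Df w b) (at z) v)) (at z)"
    by (intro has_derivative_sum has_derivative_scaleR_right D2)
  then have "((\<lambda>w. Df w (u z)) has_derivative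
      (\<lambda>v. \<Sum>b\<in>Basis. (u z \<bullet> b) *\<^sub>R frechet_derivative (\<lambda>w. Df w b) (at z) v)) (at z)"
    by (rule has_derivative_transform_within_open[OF _ U z])
      (rule linear_euclidean_expansion[OF lin, symmetric])
  from has_derivative_unique[OF this D2]
  have D2_u: "(\<Sum>b\<in>Basis. (u z \<bullet> b) *\<^sub>R frechet_derivative (\<lambda>w. Df w b) (at z) v) =
      frechet_derivative (\<lambda>w. Df w (u z)) (at z) v" for v
    by metis
  have "((\<lambda>w. \<Sum>b\<in>Basis. (u w \<bullet> b) *\<^sub>R Df w b) has_derivative
      (\<lambda>v. \<Sum>b\<in>Basis. (u z \<bullet> b) *\<^sub>R frechet_derivative (\<lambda>w. Df w b) (at z) v +
        (u' v \<bullet> b) *\<^sub>R Df z b)) (at z)"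
    by (intro has_derivative_sum has_derivative_scaleR has_derivative_inner_left u D2)
  then have "((\<lambda>w. Df w (u w)) has_derivative
      (\<lambda>v. \<Sum>b\<in>Basis. (u z \<bullet> b) *\<^sub>R frechet_derivative (\<lambda>w. Df w b) (at z) v +
        (u' v \<bullet> b) *\<^sub>R Df z b)) (at z)"
    by (rule has_derivative_transform_within_open[OF _ U z])
      (rule linear_euclidean_expansion[OF lin, symmetric])
  then show ?thesis
    unfolding sum.distrib D2_u linear_euclidean_expansion[OF lin[OF z], symmetric]
    by (simp add: Df_def)
qed

text \<open>Differentiate Df(u) = 0 along v and Df(v) = 0 along u. In the difference the second
  derivatives of f cancel by symmetry, and Df of the bracket remains.\<close>

lemma lie_bracket_annihilated:
  fixes f :: "'a::euclidean_space \<Rightarrow> real" and u v :: "'a \<Rightarrow> 'a"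
  assumes U: "open U" and f: "smooth_on U f" and z: "z \<in> U"
    and u: "(u has_derivative u') (at z)" and v: "(v has_derivative v') (at z)"
    and u0: "\<And>w. w \<in> U \<Longrightarrow> frechet_derivative f (at w) (u w) = 0"
    and v0: "\<And>w. w \<in> U \<Longrightarrow> frechet_derivative f (at w) (v w) = 0"
  shows "frechet_derivative f (at z) (v' (u z) - u' (v z)) = 0"
proof -
  have zero: "((\<lambda>w. frechet_derivative f (at w) (t w)) has_derivative (\<lambda>x. 0)) (at z)"
    if "\<And>w. w \<in> U \<Longrightarrow> frechet_derivative f (at w) (t w) = 0" for t
    by (rule has_derivative_transform_within_open[OF has_derivative_const U z])
      (simp add: that)
  have "frechet_derivative (\<lambda>w. frechet_derivative f (at w) (u z)) (at z) (v z) +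
      frechet_derivative f (at z) (u' (v z)) = 0"
    using has_derivative_unique[OF has_derivative_apply_derivative[OF f z u U] zero[OF u0]] by metis
  moreover have "frechet_derivative (\<lambda>w. frechet_derivative f (at w) (v z)) (at z) (u z) +
      frechet_derivative f (at z) (v' (u z)) = 0"
    using has_derivative_unique[OF has_derivative_apply_derivative[OF f z v U] zero[OF v0]] by metis
  moreover have "linear (frechet_derivative f (at z))"
    by (rule has_derivative_linear[OF smooth_on_has_derivative[OF f z]])
  ultimately show ?thesis
    using second_derivative_symmetric[OF U f z, of "u z" "v z"] by (simp add: linear_diff)
qed

text \<open>A 3 by 3 determinant whose rows all lie in the span of (p, q, r) and (s, t, u).\<close>

lemma determinant_zero_of_dependent:
  fixes a1 a2 b1 b2 c1 c2 p q r s t u :: real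
  shows "(a1 * p + a2 * s) * ((b1 * q + b2 * t) * (c1 * r + c2 * u) - (b1 * r + b2 * u) * (c1 * q + c2 * t)) +
    (a1 * q + a2 * t) * ((b1 * r + b2 * u) * (c1 * p + c2 * s) - (b1 * p + b2 * s) * (c1 * r + c2 * u)) +
    (a1 * r + a2 * u) * ((b1 * p + b2 * s) * (c1 * q + c2 * t) - (b1 * q + b2 * t) * (c1 * p + c2 * s)) = 0"
  by algebra

context smooth_atlas
begin

lemma vector_field_has_derivative:
  assumes "vector_field A X" "c \<in> charts_at A p"
  shows "(in_chart c (\<lambda>q. X q c) has_derivative
    frechet_derivative (in_chart c (\<lambda>q. X q c)) (at (snd c p))) (at (snd c p))"
proof (rule smooth_on_has_derivative)
  show "smooth_on (snd c ` fst c) (in_chart c (\<lambda>q. X q c))" "snd c p \<in> snd c ` fst c"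
    using assms by (auto simp: vector_field_def charts_at_def)
qed

lemma vector_field_in_tangent_space: "vector_field A X \<Longrightarrow> X p \<in> tangent_space A p"
  by (simp add: vector_field_def)

lemma in_chart_bivector_comp_wedge:
  assumes "vector_field A X" "vector_field A Y" "c \<in> A" "w \<in> snd c ` fst c"
  shows "in_chart c (bivector_comp A (wedge A Y X) c i j) w =
    in_chart c (\<lambda>q. Y q c) w $ i * in_chart c (\<lambda>q. X q c) w $ j -
    in_chart c (\<lambda>q. X q c) w $ i * in_chart c (\<lambda>q. Y q c) w $ j"
  using assms
  by (auto simp: in_chart_at bivector_comp_wedge vector_field_in_tangent_space charts_at_def)

lemma bivector_field_wedge:
  assumes "vector_field A X" "vector_field A Y"
  shows "bivector_field A (wedge A Y X)"
  unfolding bivector_field_def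
proof (intro conjI allI ballI)
  show "wedge A Y X p \<in> bivectors A p" for p
    using assms by (simp add: wedge_bivector vector_field_in_tangent_space)
  fix c i j assume c: "c \<in> A"
  note op = chart_open_range[OF c]
  have comp: "smooth_on (snd c ` fst c) (\<lambda>w. in_chart c (\<lambda>q. Z q c) w $ i)"
    if "vector_field A Z" for Z i
    by (rule smooth_on_bounded_linear[OF op bounded_linear_vec_nth])
      (use that c in \<open>simp add: vector_field_def\<close>)
  have "smooth_on (snd c ` fst c) (\<lambda>w. in_chart c (\<lambda>q. Y q c) w $ i * in_chart c (\<lambda>q. X q c) w $ j -
      in_chart c (\<lambda>q. X q c) w $ i * in_chart c (\<lambda>q. Y q c) w $ j)"
    by (intro smooth_on_diff smooth_on_mult op comp assms)
  then show "smooth_on (snd c ` fst c) (in_chart c (bivector_comp A (wedge A Y X) c i j))"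
    by (rule smooth_on_cong[OF op, rotated]) (simp add: in_chart_bivector_comp_wedge assms c)
qed

definition lie_bracket ::
  "('a \<Rightarrow> ('a, 'm) tvec) \<Rightarrow> ('a \<Rightarrow> ('a, 'm) tvec) \<Rightarrow> ('a, 'm) chart \<Rightarrow> 'a \<Rightarrow> real ^ 'm"
  where "lie_bracket X Y c p =
    frechet_derivative (in_chart c (\<lambda>q. Y q c)) (at (snd c p)) (X p c) -
    frechet_derivative (in_chart c (\<lambda>q. X q c)) (at (snd c p)) (Y p c)"

text \<open>The right-hand side is twice the determinant of the components i, j, k of X, Y and
  [X, Y]. The factor 2 arises because both arguments of the bracket are the same bivector
  field.\<close>

lemma schouten_bracket_wedge:
  assumes X: "vector_field A X" and Y: "vector_field A Y" and c: "c \<in> charts_at A p"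
  defines "x \<equiv> X p c" and "y \<equiv> Y p c" and "z \<equiv> lie_bracket X Y c p"
  shows "schouten_bracket A (wedge A Y X) (wedge A Y X) c i j k p =
    2 * (x $ i * (y $ j * z $ k - y $ k * z $ j) + x $ j * (y $ k * z $ i - y $ i * z $ k) +
      x $ k * (y $ i * z $ j - y $ j * z $ i))"
proof -
  let ?\<pi> = "bivector_comp A (wedge A Y X) c"
  let ?w = "snd c p"
  have cA: "c \<in> A" "p \<in> fst c" using c by (auto simp: charts_at_def)
  define X' where "X' = frechet_derivative (in_chart c (\<lambda>q. X q c)) (at ?w)"
  define Y' where "Y' = frechet_derivative (in_chart c (\<lambda>q. Y q c)) (at ?w)"
  have D: "(in_chart c (\<lambda>q. X q c) has_derivative X') (at ?w)"
    "(in_chart c (\<lambda>q. Y q c) has_derivative Y') (at ?w)"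
    unfolding X'_def Y'_def by (rule vector_field_has_derivative[OF X c] vector_field_has_derivative[OF Y c])+
  have comp: "((\<lambda>w. f w $ i) has_derivative (\<lambda>v. f' v $ i)) (at ?w)"
    if "(f has_derivative f') (at ?w)" for f f' :: "real ^ 'm \<Rightarrow> real ^ 'm" and i
    by (rule bounded_linear.has_derivative[OF bounded_linear_vec_nth that])
  \<comment> \<open>The derivative, by the product rule, of the component with indices j and k of Y
    \<and> X.\<close>
  define B where "B j k v = y $ j * X' v $ k + Y' v $ j * x $ k - (x $ j * Y' v $ k + X' v $ j * y $ k)"
    for j k v
  have at_p: "in_chart c (\<lambda>q. X q c) ?w = x" "in_chart c (\<lambda>q. Y q c) ?w = y"
    using cA by (simp_all add: in_chart_at x_def y_def)
  have "(in_chart c (?\<pi> j k) has_derivative B j k) (at ?w)" for j k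
  proof -
    have "((\<lambda>w. in_chart c (\<lambda>q. Y q c) w $ j * in_chart c (\<lambda>q. X q c) w $ k -
        in_chart c (\<lambda>q. X q c) w $ j * in_chart c (\<lambda>q. Y q c) w $ k) has_derivative B j k) (at ?w)"
      unfolding B_def at_p[symmetric]
      by (intro has_derivative_diff has_derivative_mult comp D)
    then show ?thesis
      by (rule has_derivative_transform_within_open[OF _ chart_open_range[OF cA(1)]])
        (use cA X Y in \<open>auto simp: in_chart_bivector_comp_wedge\<close>)
  qed
  then have partial_eq: "partial c l (?\<pi> j k) p = B j k (axis l 1)" and linB: "linear (B j k)" for j k l
    using has_derivative_frechetI has_derivative_linear unfolding partial_def by metis+
  have \<pi>_eq: "?\<pi> i l p = y $ i * x $ l - x $ i * y $ l" for i l
    unfolding x_def y_def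
    by (simp add: bivector_comp_wedge c vector_field_in_tangent_space X Y)
  have S: "(\<Sum>l\<in>UNIV. ?\<pi> i l p * partial c l (?\<pi> j k) p + ?\<pi> i l p * partial c l (?\<pi> j k) p) =
      2 * (y $ i * B j k x - x $ i * B j k y)" for i j k
  proof -
    \<comment> \<open>Contracting the partial derivatives with row i of the bivector gives one
      derivative in the direction y_i x - x_i y. In the cyclic sum X differentiated along X and Y
      along Y cancel, which leaves the bracket.\<close>
    have "(\<Sum>l\<in>UNIV. (y $ i * x $ l - x $ i * y $ l) * B j k (axis l 1)) =
        B j k (\<Sum>l\<in>UNIV. (y $ i * x $ l - x $ i * y $ l) *\<^sub>R axis l 1)"
      by (simp add: linear_sum[OF linB] linear_cmul[OF linB])
    also have "(\<Sum>l\<in>UNIV. (y $ i * x $ l - x $ i * y $ l) *\<^sub>R axis l 1) = y $ i *\<^sub>R x - x $ i *\<^sub>R y"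
      by (simp add: vec_eq_iff axis_def if_distrib cong: if_cong)
    also have "B j k \<dots> = y $ i * B j k x - x $ i * B j k y"
      by (simp add: linear_diff[OF linB] linear_cmul[OF linB])
    finally show ?thesis
      unfolding partial_eq \<pi>_eq sum.distrib by simp
  qed
  have z: "z = Y' x - X' y"
    by (simp add: z_def lie_bracket_def X'_def Y'_def x_def y_def)
  show ?thesis
    unfolding schouten_bracket_def Let_def S z B_def
    by (simp add: algebra_simps)
qed

text \<open>A transverse coordinate of the foliated chart, read in \<open>c\<close>, is annihilated
  by X and Y throughout the overlap of the charts, not just at p. Hence their bracket annihilates it
  at p.\<close>

lemma lie_bracket_foliation:
  assumes X: "vector_field A X" and Y: "vector_field A Y"
    and tangent: "\<And>p. X p \<in> foliation_tangent A F p" "\<And>p. Y p \<in> foliation_tangent A F p"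
    and c: "c \<in> charts_at A p" and c': "foliated_chart A F I c'" "p \<in> fst c'" and i: "i \<notin> I"
  shows "transition_deriv c c' p (lie_bracket X Y c p) $ i = 0"
proof -
  have A: "c \<in> A" "p \<in> fst c" "c' \<in> A" "c' \<in> charts_at A p"
    using c c' by (auto simp: charts_at_def foliated_chart_def)
  let ?U = "snd c ` (fst c \<inter> fst c')"
  have U: "open ?U" by (intro chart_open_image chart_open A)
  define f where "f w = transition c c' w $ i" for w
  have f: "smooth_on ?U f"
    unfolding f_def
    by (rule smooth_on_bounded_linear[OF U bounded_linear_vec_nth transition_smooth[OF A(1,3)]])
  have Df: "frechet_derivative f (at (snd c q)) v = transition_deriv c c' q v $ i"
    if "q \<in> fst c \<inter> fst c'" for q v
  proof -
    have "c \<in> charts_at A q" "c' \<in> charts_at A q"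
      using that A by (auto simp: charts_at_def)
    from bounded_linear.has_derivative[OF bounded_linear_vec_nth transition_has_derivative[OF this]]
    show ?thesis unfolding f_def[abs_def] by (subst has_derivative_frechetI) auto
  qed
  have zero: "frechet_derivative f (at w) (in_chart c (\<lambda>q. Z q c) w) = 0"
    if Z: "\<And>p. Z p \<in> foliation_tangent A F p" and w: "w \<in> ?U" for Z w
  proof -
    obtain q where q: "q \<in> fst c \<inter> fst c'" "w = snd c q" using w by blast
    then have q_at: "c \<in> charts_at A q" "c' \<in> charts_at A q"
      using A by (auto simp: charts_at_def)
    have Zq: "Z q \<in> tangent_space A q" "Z q c' $ i = 0"
      using foliation_tangent_subset[OF c'(1) _ Z] q i by auto
    then show ?thesis
      using tangent_change[OF Zq(1) q_at] q Df[OF q(1)] A by (simp add: in_chart_at)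
  qed
  have at_p: "in_chart c (\<lambda>q. Z q c) (snd c p) = Z p c" for Z
    using A by (simp add: in_chart_at)
  have p: "snd c p \<in> ?U" using A c' by blast
  show ?thesis
    using lie_bracket_annihilated[OF U f p vector_field_has_derivative[OF X c]
        vector_field_has_derivative[OF Y c] zero[OF tangent(1)] zero[OF tangent(2)]]
      Df[of p] A c' by (simp add: lie_bracket_def at_p)
qed

text \<open>The bracket has to vanish in every chart, but the leaf directions are coordinate
  directions only in foliated ones. Two coordinate vectors of a foliated chart are therefore carried
  into \<open>c\<close>, where X, Y and [X, Y] become combinations of them.\<close>

lemma poisson_structure_wedge:
  assumes X: "vector_field A X" and Y: "vector_field A Y" and F: "regular_foliation A 2 F"
    and tangent: "\<And>p. X p \<in> foliation_tangent A F p" "\<And>p. Y p \<in> foliation_tangent A F p"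
  shows "poisson_structure A (wedge A Y X)"
  unfolding poisson_structure_def
proof (intro conjI ballI allI bivector_field_wedge X Y)
  fix c p i j k assume cp: "c \<in> A" "p \<in> fst c"
  then have c: "c \<in> charts_at A p" by (simp add: charts_at_def)
  obtain c' I where c': "p \<in> fst c'" "card I = 2" "foliated_chart A F I c'"
    using F unfolding regular_foliation_def by blast
  then have c'_at: "c' \<in> charts_at A p" by (simp add: charts_at_def foliated_chart_def)
  obtain i1 i2 where I: "I = {i1, i2}" "i1 \<noteq> i2"
    using c'(2) by (metis card_2_iff)
  define E where "E l = transition_deriv c' c p (axis l 1)" for l
  define T where "T = transition_deriv c c' p"
  have expand: "u = T u $ i1 *\<^sub>R E i1 + T u $ i2 *\<^sub>R E i2" if "\<And>i. i \<notin> I \<Longrightarrow> T u $ i = 0" for u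
  proof -
    have "T u = T u $ i1 *\<^sub>R axis i1 1 + T u $ i2 *\<^sub>R axis i2 1"
      using that I by (auto simp: vec_eq_iff axis_def)
    note arg_cong[OF this, of "transition_deriv c' c p"]
    also have "transition_deriv c' c p (T u $ i1 *\<^sub>R axis i1 1 + T u $ i2 *\<^sub>R axis i2 1) =
        T u $ i1 *\<^sub>R E i1 + T u $ i2 *\<^sub>R E i2"
      unfolding E_def
      using transition_deriv_linear[OF c'_at c] by (simp add: linear_add linear_cmul)
    finally have "transition_deriv c' c p (T u) = T u $ i1 *\<^sub>R E i1 + T u $ i2 *\<^sub>R E i2" .
    then show ?thesis
      unfolding T_def by (simp add: transition_deriv_compose[OF c c'_at c] transition_deriv_same[OF c])
  qed
  have field: "T (Z p c) $ i = 0" if "\<And>p. Z p \<in> foliation_tangent A F p" "i \<notin> I" for Z i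
    using foliation_tangent_subset[OF c'(3,1) that(1)] that(2) tangent_change[OF _ c c'_at, of "Z p"]
    unfolding T_def by metis
  define x y z where "x = T (X p c)" "y = T (Y p c)" "z = T (lie_bracket X Y c p)"
  have "X p c = x $ i1 *\<^sub>R E i1 + x $ i2 *\<^sub>R E i2"
    "Y p c = y $ i1 *\<^sub>R E i1 + y $ i2 *\<^sub>R E i2"
    "lie_bracket X Y c p = z $ i1 *\<^sub>R E i1 + z $ i2 *\<^sub>R E i2"
    unfolding x_y_z_def
    by (rule expand field[OF tangent(1)] field[OF tangent(2)],
        simp add: field[OF tangent(1)] field[OF tangent(2)]
          lie_bracket_foliation[OF X Y tangent c c'(3,1), folded T_def])+
  then have comps: "X p c $ l = x $ i1 * E i1 $ l + x $ i2 * E i2 $ l"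
    "Y p c $ l = y $ i1 * E i1 $ l + y $ i2 * E i2 $ l"
    "lie_bracket X Y c p $ l = z $ i1 * E i1 $ l + z $ i2 * E i2 $ l" for l
    by simp_all
  show "schouten_bracket A (wedge A Y X) (wedge A Y X) c i j k p = 0"
    unfolding schouten_bracket_wedge[OF X Y c] comps determinant_zero_of_dependent by simp
qed

end

section \<open>A global vector field along the leaves\<close>

context smooth_atlas
begin

text \<open>Components of a vector field depend on the chart, so the families are indexed by charts;
  functions are the constant families. Localising at a point is what allows gluing.\<close>

definition smooth_family_at ::
  "(('a, 'm) chart \<Rightarrow> 'a \<Rightarrow> 'b::euclidean_space) \<Rightarrow> 'a \<Rightarrow> bool"
  where "smooth_family_at g p \<longleftrightarrow>
    (\<exists>W. open W \<and> p \<in> W \<and> (\<forall>c\<in>A. smooth_on (snd c ` (fst c \<inter> W)) (in_chart c (g c))))"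

lemma smooth_familyI:
  assumes "\<And>p. smooth_family_at g p" "c \<in> A"
  shows "smooth_on (snd c ` fst c) (in_chart c (g c))"
proof (rule smooth_on_local)
  fix x assume "x \<in> snd c ` fst c"
  then obtain p where p: "p \<in> fst c" "x = snd c p" by blast
  obtain W where "open W" "p \<in> W" "smooth_on (snd c ` (fst c \<inter> W)) (in_chart c (g c))"
    using assms(1)[of p] assms(2) by (auto simp: smooth_family_at_def)
  then show "\<exists>T. open T \<and> x \<in> T \<and> smooth_on T (in_chart c (g c))"
    using p chart_open_image[OF assms(2)] by blast
qed

lemma smooth_familyD:
  assumes "\<And>c. c \<in> A \<Longrightarrow> smooth_on (snd c ` fst c) (in_chart c (g c))"
  shows "smooth_family_at g p"
  unfolding smooth_family_at_def by (rule exI[of _ UNIV]) (simp add: assms)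

lemma smooth_family_at_cong:
  assumes "smooth_family_at g p" "open W" "p \<in> W" "\<And>q c. q \<in> W \<Longrightarrow> g c q = g' c q"
  shows "smooth_family_at g' p"
proof -
  obtain V where V: "open V" "p \<in> V" "\<And>c. c \<in> A \<Longrightarrow> smooth_on (snd c ` (fst c \<inter> V)) (in_chart c (g c))"
    using assms(1) by (auto simp: smooth_family_at_def)
  have "smooth_on (snd c ` (fst c \<inter> (V \<inter> W))) (in_chart c (g' c))" if c: "c \<in> A" for c
  proof (rule smooth_on_cong)
    show "open (snd c ` (fst c \<inter> (V \<inter> W)))"
      using chart_open_image[OF c] V(1) assms(2) by (simp add: open_Int)
    show "smooth_on (snd c ` (fst c \<inter> (V \<inter> W))) (in_chart c (g c))"
      by (rule smooth_on_subset[OF V(3)[OF c]]) auto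
    show "in_chart c (g c) x = in_chart c (g' c) x" if "x \<in> snd c ` (fst c \<inter> (V \<inter> W))" for x
      using that c assms(4)[of _ c] by (auto simp: in_chart_at)
  qed
  then show ?thesis
    unfolding smooth_family_at_def using V assms(2,3) by (intro exI[of _ "V \<inter> W"]) auto
qed

lemma smooth_family_at_const: "smooth_family_at (\<lambda>_ _. a) p"
  by (rule smooth_familyD) (simp add: in_chart_def o_def smooth_on_const)

lemma smooth_family_at_binary:
  fixes g :: "('a, 'm) chart \<Rightarrow> 'a \<Rightarrow> 'b::euclidean_space"
    and g' :: "('a, 'm) chart \<Rightarrow> 'a \<Rightarrow> 'c::euclidean_space"
    and op :: "'b \<Rightarrow> 'c \<Rightarrow> 'd::euclidean_space"
  assumes op: "\<And>(S :: (real ^ 'm) set) f f'. open S \<Longrightarrow> smooth_on S f \<Longrightarrow> smooth_on S f' \<Longrightarrow>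
      smooth_on S (\<lambda>x. op (f x) (f' x))"
    and "smooth_family_at g p" "smooth_family_at g' p"
  shows "smooth_family_at (\<lambda>c q. op (g c q) (g' c q)) p"
proof -
  obtain V where V: "open V" "p \<in> V" "\<And>c. c \<in> A \<Longrightarrow> smooth_on (snd c ` (fst c \<inter> V)) (in_chart c (g c))"
    using assms(2) by (auto simp: smooth_family_at_def)
  obtain W where W: "open W" "p \<in> W" "\<And>c. c \<in> A \<Longrightarrow> smooth_on (snd c ` (fst c \<inter> W)) (in_chart c (g' c))"
    using assms(3) by (auto simp: smooth_family_at_def)
  have "smooth_on (snd c ` (fst c \<inter> (V \<inter> W))) (in_chart c (\<lambda>q. op (g c q) (g' c q)))" if c: "c \<in> A" for c
  proof -
    have "open (snd c ` (fst c \<inter> (V \<inter> W)))"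
      using chart_open_image[OF c] V(1) W(1) by (simp add: open_Int)
    moreover have "smooth_on (snd c ` (fst c \<inter> (V \<inter> W))) (in_chart c (g c))"
      by (rule smooth_on_subset[OF V(3)[OF c]]) auto
    moreover have "smooth_on (snd c ` (fst c \<inter> (V \<inter> W))) (in_chart c (g' c))"
      by (rule smooth_on_subset[OF W(3)[OF c]]) auto
    ultimately have "smooth_on (snd c ` (fst c \<inter> (V \<inter> W))) (\<lambda>x. op (in_chart c (g c) x) (in_chart c (g' c) x))"
      by (rule op)
    then show ?thesis by (simp add: in_chart_def o_def)
  qed
  then show ?thesis
    unfolding smooth_family_at_def using V W by (intro exI[of _ "V \<inter> W"]) auto
qed

lemma smooth_family_at_add:
  "smooth_family_at g p \<Longrightarrow> smooth_family_at g' p \<Longrightarrow> smooth_family_at (\<lambda>c q. g c q + g' c q) p"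
  by (rule smooth_family_at_binary[OF smooth_on_add])

lemma smooth_family_at_diff:
  "smooth_family_at g p \<Longrightarrow> smooth_family_at g' p \<Longrightarrow> smooth_family_at (\<lambda>c q. g c q - g' c q) p"
  by (rule smooth_family_at_binary[OF smooth_on_diff])

lemma smooth_family_at_scaleR:
  "smooth_family_at g p \<Longrightarrow> smooth_family_at g' p \<Longrightarrow> smooth_family_at (\<lambda>c q. g c q *\<^sub>R g' c q) p"
  by (rule smooth_family_at_binary[OF smooth_on_scaleR])

text \<open>Smoothness in one chart around the point is enough, since the other local expressions
  arise by composition with transition maps.\<close>

lemma smooth_family_at_function:
  fixes f :: "'a \<Rightarrow> 'b::euclidean_space"
  assumes "c0 \<in> A" "p \<in> fst c0" "smooth_on (snd c0 ` fst c0) (in_chart c0 f)"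
  shows "smooth_family_at (\<lambda>_. f) p"
proof -
  have "smooth_on (snd c ` (fst c \<inter> fst c0)) (in_chart c f)" if c: "c \<in> A" for c
  proof -
    let ?S = "snd c ` (fst c \<inter> fst c0)"
    have S: "open ?S" by (rule chart_open_image[OF c chart_open[OF assms(1)]])
    have "transition c c0 ` ?S \<subseteq> snd c0 ` fst c0"
      using c by (auto simp: transition_at)
    from smooth_on_compose[OF S this assms(3) transition_smooth[OF c assms(1)]]
    show ?thesis
      by (rule smooth_on_cong[OF S, rotated]) (use c assms in \<open>auto simp: transition_at in_chart_at\<close>)
  qed
  then show ?thesis
    unfolding smooth_family_at_def using assms chart_open by blast
qed

lemma smooth_family_at_tangent_vector:
  assumes c0: "c0 \<in> A" "p \<in> fst c0" and u: "smooth_on (snd c0 ` fst c0) u"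
  shows "smooth_family_at (\<lambda>c q. tangent_vector A c0 q (u (snd c0 q)) c) p"
proof -
  have "smooth_on (snd c ` (fst c \<inter> fst c0))
      (in_chart c (\<lambda>q. tangent_vector A c0 q (u (snd c0 q)) c))" if c: "c \<in> A" for c
  proof -
    let ?S = "snd c ` (fst c \<inter> fst c0)" and ?T = "snd c0 ` (fst c0 \<inter> fst c)"
    \<comment> \<open>The component in \<open>c\<close>, still as a function of the coordinates of
      \<open>c0\<close>; precomposition with the transition map reads it in
      \<open>c\<close>.\<close>
    define G where "G x = frechet_derivative (transition c0 c) (at x) (u x)" for x
    have S: "open ?S" "open ?T" by (intro chart_open_image chart_open c c0)+
    note tr = transition_smooth[OF c0(1) c]
    have "smooth_on ?T G"
      unfolding G_def
      by (rule smooth_on_apply_derivative[OF S(2) has_derivative_linear[OF smooth_on_has_derivative[OF tr]]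
            smooth_on_frechet_derivative[OF tr] smooth_on_subset[OF u]]) auto
    moreover have "transition c c0 ` ?S \<subseteq> ?T"
      using c by (auto simp: transition_at)
    ultimately have "smooth_on ?S (\<lambda>x. G (transition c c0 x))"
      using smooth_on_compose[OF S(1)] transition_smooth[OF c c0(1)] by blast
    then show ?thesis
      by (rule smooth_on_cong[OF S(1), rotated])
        (use c c0 in \<open>auto simp: transition_at in_chart_at G_def tangent_vector_def charts_at_def
          transition_deriv_def\<close>)
  qed
  then show ?thesis
    unfolding smooth_family_at_def using c0 chart_open by blast
qed

lemma vector_field_iff:
  "vector_field A Y \<longleftrightarrow>
    (\<forall>p. Y p \<in> tangent_space A p) \<and> (\<forall>p. smooth_family_at (\<lambda>c q. Y q c) p)"
  unfolding vector_field_def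
  using smooth_familyI[of "\<lambda>c q. Y q c"] smooth_familyD[of "\<lambda>c q. Y q c"] by blast

text \<open>The support lies in the chart preimage K of a closed ball. K is compact, hence closed in
  the Hausdorff manifold, so extension by 0 is smooth also at boundary points of the chart
  domain.\<close>

lemma bump_function_in_chart:
  assumes c: "c \<in> A" and p: "p \<in> fst c"
  obtains f V K where "open V" "p \<in> V" "\<And>q. q \<in> V \<Longrightarrow> f q = (1::real)"
    "\<And>q. smooth_family_at (\<lambda>_. f) q" "closed K" "K \<subseteq> fst c" "\<And>q. q \<notin> K \<Longrightarrow> f q = 0"
proof -
  obtain e where e: "e > 0" "cball (snd c p) e \<subseteq> snd c ` fst c"
    using chart_open_range[OF c] p by (meson imageI open_contains_cball)
  define r where "r = e / 2"
  have r: "r > 0" "e = 2 * r" using e by (auto simp: r_def)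
  obtain \<beta> :: "real ^ 'm \<Rightarrow> real" where \<beta>: "smooth_on UNIV \<beta>"
      "\<And>y. y \<in> ball (snd c p) r \<Longrightarrow> \<beta> y = 1" "\<And>y. y \<notin> ball (snd c p) (2 * r) \<Longrightarrow> \<beta> y = 0"
    by (rule bump_function_exists[OF r(1), of "snd c p"]) (rule that)
  define f where "f q = (if q \<in> fst c then \<beta> (snd c q) else 0)" for q
  define V where "V = fst c \<inter> snd c -` ball (snd c p) r"
  define K where "K = inv_into (fst c) (snd c) ` cball (snd c p) e"
  have "open V"
    unfolding V_def
    using continuous_open_preimage[OF chart_continuous(1)[OF c] chart_open[OF c] open_ball] .
  moreover have "p \<in> V" using p r by (simp add: V_def)
  moreover have "f q = 1" if "q \<in> V" for q
    using that \<beta>(2) by (simp add: V_def f_def)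
  moreover have "compact K"
    unfolding K_def
    by (intro compact_continuous_image compact_cball continuous_on_subset[OF chart_continuous(2)[OF c] e(2)])
  then have K: "closed K" by (rule compact_imp_closed)
  moreover have "K \<subseteq> fst c"
    unfolding K_def using e(2) by (auto intro: inv_into_into)
  moreover have f0: "f q = 0" if "q \<notin> K" for q
  proof (cases "q \<in> fst c")
    case True
    have "snd c q \<notin> cball (snd c p) e"
      using that chart_inverse[OF c True] unfolding K_def by (metis imageI)
    then show ?thesis
      using \<beta>(3) r(2) by (auto simp: f_def)
  qed (simp add: f_def)
  moreover have "smooth_family_at (\<lambda>_. f) q" for q
  proof (cases "q \<in> fst c")
    case True
    have "smooth_on (snd c ` fst c) \<beta>"
      by (rule smooth_on_subset[OF \<beta>(1)]) simp
    then have "smooth_on (snd c ` fst c) (in_chart c f)"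
      by (rule smooth_on_cong[OF chart_open_range[OF c], rotated])
        (use c in \<open>auto simp: in_chart_at f_def\<close>)
    then show ?thesis by (rule smooth_family_at_function[OF c True])
  next
    case False
    then show ?thesis
      using smooth_family_at_cong[OF smooth_family_at_const[of 0 q], of "- K" "\<lambda>_. f"]
        f0 K \<open>K \<subseteq> fst c\<close> by auto
  qed
  ultimately show thesis using that by blast
qed

text \<open>dh vanishes on tangent vectors of the level sets. If it vanished along the leaf as well,
  transversality would make it vanish on the whole tangent space.\<close>

lemma differential_nonzero_on_foliation:
  assumes h: "smooth_function A h" and dh: "differential A h p \<noteq> 0" and F: "partition_on UNIV F"
    and tr: "transversal A F {h -` {r} | r. True}"
  shows "\<exists>v\<in>foliation_tangent A F p. differential A h p v \<noteq> 0"
proof (rule ccontr)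
  assume *: "\<not> ?thesis"
  have "p \<in> \<Union> F" using F by (simp add: partition_on_def)
  then obtain L where L: "L \<in> F" "p \<in> L" by blast
  have "h -` {h p} \<in> {h -` {r} | r. True}" by blast
  then have sum: "{u + w | u w. u \<in> tangent_to A L p \<and> w \<in> tangent_to A (h -` {h p}) p} = tangent_space A p"
    using tr L unfolding transversal_def by blast
  have "differential A h p x = 0" for x
  proof (cases "x \<in> tangent_space A p")
    case True
    then obtain u w where x: "x = u + w" "u \<in> tangent_to A L p" "w \<in> tangent_to A (h -` {h p}) p"
      using sum by blast
    have "u \<in> foliation_tangent A F p"
      using x L by (auto simp: foliation_tangent_def)
    then have "differential A h p u = 0" using * by blast
    moreover have "differential A h p w = 0"
      by (rule differential_tangent_to_level_set[OF h x(3)])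
    ultimately show ?thesis
      using cotangent_linear[OF differential_smooth_function_cotangent[OF h]
          tangent_to_in_tangent_space[OF x(2)] tangent_to_in_tangent_space[OF x(3)], of 1 1] x(1)
      by simp
  qed (simp add: differential_def)
  then show False using dh by (simp add: fun_eq_iff)
qed

lemma foliation_tangent_comb:
  assumes F: "regular_foliation A k F"
    and "u \<in> foliation_tangent A F p" "v \<in> foliation_tangent A F p"
  shows "a *\<^sub>R u + b *\<^sub>R v \<in> foliation_tangent A F p"
proof -
  obtain c I where c: "p \<in> fst c" "foliated_chart A F I c"
    using F unfolding regular_foliation_def by blast
  show ?thesis
    using assms(2,3) tangent_space_comb
    unfolding foliation_tangent_iff[OF c(2,1)] by (simp add: scaleR_fun_def)
qed

lemma foliation_tangent_zero:
  assumes F: "regular_foliation A k F"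
  shows "0 \<in> foliation_tangent A F p"
proof -
  obtain c I where c: "p \<in> fst c" "foliated_chart A F I c"
    using F unfolding regular_foliation_def by blast
  show ?thesis
    unfolding foliation_tangent_iff[OF c(2,1)] using subspace_0[OF subspace_tangent_space] by simp
qed

lemma foliation_tangent_in_tangent_space:
  "v \<in> foliation_tangent A F p \<Longrightarrow> v \<in> tangent_space A p"
  unfolding foliation_tangent_def using tangent_to_in_tangent_space by blast

text \<open>On the coordinates along the leaves, the gradient of \<open>h\<close> divided by its squared length.\<close>

lemma normalized_field_in_foliated_chart:
  assumes h: "smooth_function A h"
    and c: "foliated_chart A F {i, j} c" and ij: "i \<noteq> j"
    and nz: "\<And>p. \<exists>v\<in>foliation_tangent A F p. differential A h p v \<noteq> 0"
  obtains u where "smooth_on (snd c ` fst c) u"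
    "\<And>q. q \<in> fst c \<Longrightarrow> tangent_vector A c q (u (snd c q)) \<in> foliation_tangent A F q"
    "\<And>q. q \<in> fst c \<Longrightarrow> differential A h q (tangent_vector A c q (u (snd c q))) = 1"
proof -
  have cA: "c \<in> A" using c by (simp add: foliated_chart_def)
  let ?S = "snd c ` fst c"
  have S: "open ?S" by (rule chart_open_range[OF cA])
  have hc: "smooth_on ?S (in_chart c h)"
    using h cA by (simp add: smooth_function_def)
  define a where "a k x = frechet_derivative (in_chart c h) (at x) (axis k 1)" for k x
  have a: "smooth_on ?S (a k)" for k
    unfolding a_def by (rule smooth_on_frechet_derivative[OF hc])
  define n where "n x = a i x * a i x + a j x * a j x" for x
  define u where "u x = (a i x / n x) *\<^sub>R axis i 1 + (a j x / n x) *\<^sub>R (axis j 1 :: real ^ 'm)" for x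
  have lin: "linear (frechet_derivative (in_chart c h) (at x))" if "x \<in> ?S" for x
    by (rule has_derivative_linear[OF smooth_on_has_derivative[OF hc that]])
  have D: "differential A h q v = frechet_derivative (in_chart c h) (at (snd c q)) (v c)"
    if "q \<in> fst c" "v \<in> tangent_space A q" for q v
    using differential_smooth_function_eq[OF h _ that(2)] that cA by (simp add: charts_at_def)
  have "n x \<noteq> 0" if x: "x \<in> ?S" for x
  proof -
    obtain q where q: "q \<in> fst c" "x = snd c q" using x by blast
    obtain v where v: "v \<in> foliation_tangent A F q" "differential A h q v \<noteq> 0"
      using nz by blast
    \<comment> \<open>Only leaf components of v survive, so dh(v) is a combination of the two leaf
      derivatives of h, which cannot both be 0.\<close>
    have "v c = v c $ i *\<^sub>R axis i 1 + v c $ j *\<^sub>R axis j 1"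
      using foliation_tangent_subset(2)[OF c q(1) v(1)] ij by (auto simp: vec_eq_iff axis_def)
    from arg_cong[OF this, of "frechet_derivative (in_chart c h) (at x)"]
    have "differential A h q v = v c $ i * a i x + v c $ j * a j x"
      using D[OF q(1) foliation_tangent_in_tangent_space[OF v(1)]] lin[OF x] q(2)
      by (simp add: linear_add linear_cmul a_def)
    then have "a i x \<noteq> 0 \<or> a j x \<noteq> 0" using v(2) by auto
    then show ?thesis by (simp add: n_def sum_squares_eq_zero_iff)
  qed
  note n = this
  have "smooth_on ?S n"
    unfolding n_def by (intro smooth_on_add smooth_on_mult a S)
  then have "smooth_on ?S u"
    unfolding u_def
    by (intro smooth_on_add smooth_on_scaleR smooth_on_divide smooth_on_const a S n)
  moreover have "tangent_vector A c q (u (snd c q)) \<in> foliation_tangent A F q"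
    and "differential A h q (tangent_vector A c q (u (snd c q))) = 1" if q: "q \<in> fst c" for q
  proof -
    have c_at: "c \<in> charts_at A q" using cA q by (simp add: charts_at_def)
    let ?v = "tangent_vector A c q (u (snd c q))"
    have v: "?v \<in> tangent_space A q" "?v c = u (snd c q)"
      by (rule tangent_vector_in_tangent_space[OF c_at] tangent_vector_component[OF c_at])+
    show "?v \<in> foliation_tangent A F q"
      unfolding foliation_tangent_iff[OF c q] v(2) using v(1) by (auto simp: u_def axis_def)
    have x: "snd c q \<in> ?S" using q by blast
    have "differential A h q ?v = (a i (snd c q) / n (snd c q)) * a i (snd c q) +
        (a j (snd c q) / n (snd c q)) * a j (snd c q)"
      unfolding D[OF q v(1)] v(2) unfolding u_def
      using lin[OF x] by (simp add: linear_add linear_cmul a_def)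
    also have "\<dots> = (a i (snd c q) * a i (snd c q) + a j (snd c q) * a j (snd c q)) / n (snd c q)"
      by (simp add: add_divide_distrib)
    also have "\<dots> = n (snd c q) / n (snd c q)"
      by (simp only: n_def)
    finally show "differential A h q ?v = 1" using n[OF x] by simp
  qed
  ultimately show thesis using that by blast
qed

text \<open>A bump function f times the normalized field of a chart is globally defined. Then dh of
  it is f itself, so f records how far the normalization dh = 1 is achieved.\<close>

lemma local_normalized_field:
  assumes h: "smooth_function A h" and F: "regular_foliation A 2 F"
    and nz: "\<And>p. \<exists>v\<in>foliation_tangent A F p. differential A h p v \<noteq> 0"
  shows "\<exists>V Z f. open V \<and> p \<in> V \<and> vector_field A Z \<and> (\<forall>q. Z q \<in> foliation_tangent A F q) \<and>
    (\<forall>q. smooth_family_at (\<lambda>_. f) q) \<and> (\<forall>q. differential A h q (Z q) = f q) \<and> (\<forall>q\<in>V. f q = 1)"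
proof -
  obtain c I where c: "p \<in> fst c" "card I = 2" "foliated_chart A F I c"
    using F unfolding regular_foliation_def by blast
  obtain i j where I: "I = {i, j}" "i \<noteq> j"
    using c(2) by (metis card_2_iff)
  have cA: "c \<in> A" using c by (simp add: foliated_chart_def)
  obtain u where u: "smooth_on (snd c ` fst c) u"
    "\<And>q. q \<in> fst c \<Longrightarrow> tangent_vector A c q (u (snd c q)) \<in> foliation_tangent A F q"
    "\<And>q. q \<in> fst c \<Longrightarrow> differential A h q (tangent_vector A c q (u (snd c q))) = 1"
    by (rule normalized_field_in_foliated_chart[OF h c(3)[unfolded I(1)] I(2) nz]) (rule that)
  obtain f V K where f: "open V" "p \<in> V" "\<And>q. q \<in> V \<Longrightarrow> f q = (1::real)"
    "\<And>q. smooth_family_at (\<lambda>_. f) q" "closed K" "K \<subseteq> fst c" "\<And>q. q \<notin> K \<Longrightarrow> f q = 0"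
    by (rule bump_function_in_chart[OF cA c(1)]) (rule that)
  \<comment> \<open>Outside the chart the second factor carries no meaning; there f is 0.\<close>
  define Z where "Z q = f q *\<^sub>R tangent_vector A c q (u (snd c q))" for q
  have Z0: "Z q = 0" if "q \<notin> K" for q
    using f(7)[OF that] by (simp add: Z_def)
  have tangent: "Z q \<in> foliation_tangent A F q" for q
  proof (cases "q \<in> K")
    case True
    then show ?thesis
      using foliation_tangent_comb[OF F u(2) foliation_tangent_zero[OF F], of q "f q" 0] f(6)
      by (auto simp: Z_def)
  qed (simp add: Z0 foliation_tangent_zero[OF F])
  have diff: "differential A h q (Z q) = f q" for q
  proof (cases "q \<in> K")
    case True
    then have q: "q \<in> fst c" using f(6) by blast
    show ?thesis
      using cotangent_linear[OF differential_smooth_function_cotangent[OF h]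
          foliation_tangent_in_tangent_space[OF u(2)[OF q]]
          foliation_tangent_in_tangent_space[OF u(2)[OF q]], of "f q" 0] u(3)[OF q]
      by (simp add: Z_def)
  qed (simp add: Z0 f(7) cotangent_zero[OF differential_smooth_function_cotangent[OF h]])
  have smooth: "smooth_family_at (\<lambda>c' q. Z q c') q" for q
  proof (cases "q \<in> fst c")
    case True
    show ?thesis
      using smooth_family_at_scaleR[OF f(4) smooth_family_at_tangent_vector[OF cA True u(1)]]
      by (simp add: Z_def scaleR_fun_def)
  next
    case False
    then show ?thesis
      using smooth_family_at_cong[OF smooth_family_at_const[of 0 q], of "- K" "\<lambda>c' q. Z q c'"]
        Z0 f(5,6) by auto
  qed
  have "vector_field A Z"
    unfolding vector_field_iff
    using smooth tangent foliation_tangent_in_tangent_space by blast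
  then show ?thesis
    using f(1-4) tangent diff by blast
qed

text \<open>Instead of a partition of unity: run through a countable cover and correct the field obtained
  so far by the multiple of the next local field that is missing for \<open>dh(Y) = 1\<close>. No correction
  happens any more at a point once the equation holds there.\<close>

lemma global_normalized_field:
  assumes h: "smooth_function A h" and F: "regular_foliation A 2 F"
    and nz: "\<And>p. \<exists>v\<in>foliation_tangent A F p. differential A h p v \<noteq> 0"
  obtains Y where "vector_field A Y" "\<And>p. Y p \<in> foliation_tangent A F p"
    "\<And>p. differential A h p (Y p) = 1"
proof -
  obtain V Z f where VZ: "\<And>p. open (V p)" "\<And>p. p \<in> V p" "\<And>p. vector_field A (Z p)"
    "\<And>p q. Z p q \<in> foliation_tangent A F q" "\<And>p q. smooth_family_at (\<lambda>_. f p) q"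
    "\<And>p q. differential A h q (Z p q) = f p q" "\<And>p q. q \<in> V p \<Longrightarrow> f p q = 1"
    using local_normalized_field[OF assms] by metis
  \<comment> \<open>Second countability reduces the cover to a countable one, so the corrections can
    be made one after another.\<close>
  obtain \<V> where \<V>: "\<V> \<subseteq> range V" "countable \<V>" "\<Union> \<V> = \<Union> (range V)"
    using Lindelof[of "range V"] VZ(1) by blast
  have UN: "\<Union> \<V> = UNIV" using \<V>(3) VZ(2) by blast
  then have "\<V> \<noteq> {}" by blast
  then have range: "range (from_nat_into \<V>) = \<V>"
    using \<V>(2) by (rule range_from_nat_into)
  then have "\<exists>p. from_nat_into \<V> n = V p" for n
    using \<V>(1) by blast
  then obtain x where x: "\<And>n. from_nat_into \<V> n = V (x n)" by metis
  have cover: "\<exists>n. q \<in> V (x n)" for q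
    using UN range x by (metis UNIV_I UnionE rangeE)
  \<comment> \<open>The coefficient 1 gives each step the form of a linear combination, as the
    linearity lemmas expect.\<close>
  define S where "S = rec_nat (\<lambda>q. 0)
    (\<lambda>n S q. 1 *\<^sub>R S q + (1 - differential A h q (S q)) *\<^sub>R Z (x n) q)"
  have S_0: "S 0 q = 0" and S_Suc: "S (Suc n) q =
      1 *\<^sub>R S n q + (1 - differential A h q (S n q)) *\<^sub>R Z (x n) q" for n q
    by (simp_all add: S_def)
  have S_tangent: "S n q \<in> foliation_tangent A F q" for n q
    by (induction n) (simp_all only: S_0 S_Suc foliation_tangent_zero[OF F]
        foliation_tangent_comb[OF F] VZ(4))
  \<comment> \<open>Equivalently, the defect 1 - dh(S) is multiplied by 1 - f at each step, so it
    becomes 0 wherever f = 1.\<close>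
  have dS: "differential A h q (S (Suc n) q) = 1 * differential A h q (S n q) +
      (1 - differential A h q (S n q)) * f (x n) q" for n q
    unfolding S_Suc VZ(6)[symmetric]
    by (rule cotangent_linear[OF differential_smooth_function_cotangent[OF h]
          foliation_tangent_in_tangent_space[OF S_tangent] foliation_tangent_in_tangent_space[OF VZ(4)]])
  \<comment> \<open>Both claims go through one induction, as dh of the current field is a
    coefficient of the next one; its own smoothness follows from the recursion for dh.\<close>
  have S_smooth: "smooth_family_at (\<lambda>c q. S n q c) p \<and>
      smooth_family_at (\<lambda>_ q. differential A h q (S n q)) p" for n p
  proof (induction n)
    case 0
    have d0: "differential A h q 0 = 0" for q
      by (rule cotangent_zero[OF differential_smooth_function_cotangent[OF h]])
    show ?case
      unfolding S_0 d0 by (simp add: smooth_family_at_const)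
  next
    case (Suc n)
    have "smooth_family_at (\<lambda>c q. Z (x n) q c) p"
      using VZ(3) by (simp add: vector_field_iff)
    then have "smooth_family_at (\<lambda>c q. S n q c + (1 - differential A h q (S n q)) *\<^sub>R Z (x n) q c) p"
      by (intro smooth_family_at_add smooth_family_at_scaleR smooth_family_at_diff
          smooth_family_at_const conjunct1[OF Suc] conjunct2[OF Suc])
    moreover have "smooth_family_at (\<lambda>_ q. differential A h q (S n q) +
        (1 - differential A h q (S n q)) *\<^sub>R f (x n) q) p"
      by (intro smooth_family_at_add smooth_family_at_scaleR smooth_family_at_diff
          smooth_family_at_const conjunct2[OF Suc] VZ(5))
    ultimately show ?case
      by (simp only: dS) (simp add: S_Suc scaleR_fun_def)
  qed
  have done_step: "differential A h q (S (Suc n) q) = 1" if "q \<in> V (x n)" for n q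
    using dS[of q n] VZ(7)[OF that] by simp
  have stationary: "S (m + k) q = S m q" if "differential A h q (S m q) = 1" for m k q
    by (induction k) (simp_all add: S_Suc that)
  \<comment> \<open>The least index may jump from point to point, but the field no longer changes
    once normalized. On each member of the cover Y therefore equals one fixed stage, which makes it
    smooth.\<close>
  define Y where "Y q = S (Suc (LEAST n. q \<in> V (x n))) q" for q
  have Y_eq: "Y q = S (Suc n) q" if "q \<in> V (x n)" for n q
  proof -
    let ?l = "LEAST n. q \<in> V (x n)"
    have "q \<in> V (x ?l)" "?l \<le> n"
      using that by (auto intro: LeastI Least_le)
    then show ?thesis
      using stationary[OF done_step, of q ?l "n - ?l"] by (simp add: Y_def)
  qed
  have "smooth_family_at (\<lambda>c q. Y q c) p" for p
  proof -
    obtain n where n: "p \<in> V (x n)" using cover by blast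
    show ?thesis
      by (rule smooth_family_at_cong[OF conjunct1[OF S_smooth[of "Suc n"]] VZ(1) n]) (simp add: Y_eq)
  qed
  moreover have Y_tangent: "Y q \<in> foliation_tangent A F q" for q
    unfolding Y_def by (rule S_tangent)
  ultimately have "vector_field A Y"
    unfolding vector_field_iff using foliation_tangent_in_tangent_space by blast
  moreover have "differential A h q (Y q) = 1" for q
    using cover[of q] Y_eq done_step by auto
  ultimately show thesis using that Y_tangent by blast
qed

end

section \<open>The Poisson structure\<close>

text \<open>Transversality and the absence of critical points enter through their consequence
  \<open>dh_nonzero\<close>.\<close>

locale foliation_with_first_integral = smooth_atlas A
  for A :: "('a::{t2_space,second_countable_topology}, 'm::finite) chart set" +
  fixes X :: "'a \<Rightarrow> ('a, 'm) tvec" and h :: "'a \<Rightarrow> real" and F :: "'a set set"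
  assumes X: "vector_field A X"
    and h: "smooth_function A h"
    and first_integral: "\<And>p. differential A h p (X p) = 0"
    and foliation: "regular_foliation A 2 F"
    and X_tangent: "\<And>p. X p \<in> foliation_tangent A F p"
    and dh_nonzero: "\<And>p. \<exists>v\<in>foliation_tangent A F p. differential A h p v \<noteq> 0"
begin

section \<open>Linear algebra of dh and X in a leaf plane\<close>

lemma dh_cotangent: "differential A h p \<in> cotangent_space A p"
  by (rule differential_smooth_function_cotangent[OF h])

lemma X_in_tangent_space: "X p \<in> tangent_space A p"
  by (rule vector_field_in_tangent_space[OF X])

text \<open>On the tangent plane of a leaf dh is a nonzero functional, so its kernel is a line; a
  nonzero X in the kernel spans it.\<close>

lemma dh_kernel:
  assumes u: "u \<in> foliation_tangent A F p" "differential A h p u = 0" and X0: "X p \<noteq> 0"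
  shows "\<exists>t. u = t *\<^sub>R X p"
proof -
  obtain c I where c: "p \<in> fst c" "card I = 2" "foliated_chart A F I c"
    using foliation unfolding regular_foliation_def by blast
  obtain i j where I: "I = {i, j}" "i \<noteq> j"
    using c(2) by (metis card_2_iff)
  have c_at: "c \<in> charts_at A p" using c by (simp add: foliated_chart_def charts_at_def)
  define D where "D = frechet_derivative (in_chart c h) (at (snd c p))"
  have lin: "linear D"
    unfolding D_def by (rule has_derivative_linear[OF smooth_function_has_derivative[OF h c_at]])
  have expand: "v c = v c $ i *\<^sub>R axis i 1 + v c $ j *\<^sub>R axis j 1" if "v \<in> foliation_tangent A F p" for v
    using foliation_tangent_subset(2)[OF c(3,1) that] I by (auto simp: vec_eq_iff axis_def)
  have dh: "differential A h p v = v c $ i * D (axis i 1) + v c $ j * D (axis j 1)"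
    if v: "v \<in> foliation_tangent A F p" for v
    using arg_cong[OF expand[OF v], of D] lin
      differential_smooth_function_eq[OF h c_at foliation_tangent_in_tangent_space[OF v]]
    by (simp add: linear_add linear_cmul D_def)
  let ?a = "D (axis i 1)" and ?b = "D (axis j 1)"
  have ab: "?a \<noteq> 0 \<or> ?b \<noteq> 0"
    using dh_nonzero[of p] dh by fastforce
  have eqs: "u c $ i * ?a + u c $ j * ?b = 0" "X p c $ i * ?a + X p c $ j * ?b = 0"
    using dh[OF u(1)] dh[OF X_tangent] u(2) first_integral by simp_all
  \<comment> \<open>The components of u and X solve the same nontrivial linear equation in two
    unknowns, so their determinant vanishes.\<close>
  have "?a * (u c $ i * X p c $ j - u c $ j * X p c $ i) = 0"
    "?b * (u c $ i * X p c $ j - u c $ j * X p c $ i) = 0"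
    using eqs by algebra+
  then have cross: "u c $ i * X p c $ j = u c $ j * X p c $ i"
    using ab by auto
  have "X p c \<noteq> 0"
    using X0 tangent_eqI[OF X_in_tangent_space subspace_0[OF subspace_tangent_space] c_at] by auto
  then have X_ij: "X p c $ i \<noteq> 0 \<or> X p c $ j \<noteq> 0"
    using expand[OF X_tangent] by (metis add_0 scaleR_zero_left)
  obtain t where t: "u c $ i = t * X p c $ i" "u c $ j = t * X p c $ j"
  proof (cases "X p c $ i = 0")
    case True
    then show thesis
      using X_ij cross that[of "u c $ j / X p c $ j"] by auto
  next
    case False
    then show thesis
      using cross that[of "u c $ i / X p c $ i"] by (simp add: field_simps)
  qed
  have "u c = (t *\<^sub>R X p) c"
    unfolding vec_eq_iff
  proof
    fix k
    show "u c $ k = (t *\<^sub>R X p) c $ k"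
      using t I foliation_tangent_subset(2)[OF c(3,1) u(1), of k]
        foliation_tangent_subset(2)[OF c(3,1) X_tangent, of k]
      by (cases "k \<in> I") (auto simp: scaleR_fun_def)
  qed
  then have "u = t *\<^sub>R X p"
    using tangent_eqI[OF foliation_tangent_in_tangent_space[OF u(1)]
        subspace_scale[OF subspace_tangent_space X_in_tangent_space] c_at] by blast
  then show ?thesis ..
qed

text \<open>Subtracting dh(u) v from u lands in the kernel of dh on the leaf plane.\<close>

lemma foliation_tangent_expansion:
  assumes "u \<in> foliation_tangent A F p" "v \<in> foliation_tangent A F p" "differential A h p v = 1" "X p \<noteq> 0"
  shows "\<exists>t. u = differential A h p u *\<^sub>R v + t *\<^sub>R X p"
proof -
  let ?w = "1 *\<^sub>R u + (- differential A h p u) *\<^sub>R v"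
  have "?w \<in> foliation_tangent A F p"
    by (rule foliation_tangent_comb[OF foliation assms(1,2)])
  moreover have "differential A h p ?w = 0"
    using cotangent_linear[OF dh_cotangent foliation_tangent_in_tangent_space[OF assms(1)]
        foliation_tangent_in_tangent_space[OF assms(2)], of 1 "- differential A h p u"] assms(3)
    by simp
  ultimately obtain t where "?w = t *\<^sub>R X p"
    using dh_kernel assms(4) by blast
  then have "u = differential A h p u *\<^sub>R v + t *\<^sub>R X p"
    by (simp add: algebra_simps)
  then show ?thesis ..
qed

text \<open>Y and Y' differ by a multiple of X, which the wedge with X removes.\<close>

lemma wedge_normalized_unique:
  assumes "Y p \<in> foliation_tangent A F p" "differential A h p (Y p) = 1"
    "Y' p \<in> foliation_tangent A F p" "differential A h p (Y' p) = 1" "X p \<noteq> 0"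
  shows "wedge A Y X p = wedge A Y' X p"
proof -
  obtain t where t: "Y p = 1 *\<^sub>R Y' p + t *\<^sub>R X p"
    using foliation_tangent_expansion[OF assms(1,3,4,5)] assms(2) by auto
  have expand: "\<alpha> (Y p) = 1 * \<alpha> (Y' p) + t * \<alpha> (X p)" if "\<alpha> \<in> cotangent_space A p" for \<alpha>
    unfolding t
    by (rule cotangent_linear[OF that foliation_tangent_in_tangent_space[OF assms(3)] X_in_tangent_space])
  show ?thesis
  proof (intro ext)
    fix \<alpha> \<beta>
    show "wedge A Y X p \<alpha> \<beta> = wedge A Y' X p \<alpha> \<beta>"
      using expand[of \<alpha>] expand[of \<beta>] by (auto simp: wedge_def algebra_simps)
  qed
qed

section \<open>Image and rank of Y \<and> X\<close>

lemma wedge_zero: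
  assumes "X p = 0"
  shows "wedge A Y X p = 0"
proof (intro ext)
  fix \<alpha> \<beta>
  show "wedge A Y X p \<alpha> \<beta> = 0 \<alpha> \<beta>"
    using assms cotangent_zero[of \<alpha> p] cotangent_zero[of \<beta> p] by (simp add: wedge_def)
qed

lemma sharp_wedge_dh:
  assumes "Y p \<in> tangent_space A p"
  shows "sharp A (wedge A Y X) p (differential A h p) = differential A h p (Y p) *\<^sub>R X p"
  using sharp_wedge[of X p Y, OF X_in_tangent_space assms dh_cotangent] by (simp add: first_integral)

lemma sharp_wedge_image:
  assumes "Y p \<in> tangent_space A p" "differential A h p (Y p) = 1" "X p \<noteq> 0"
  shows "sharp A (wedge A Y X) p ` cotangent_space A p = {s *\<^sub>R Y p + t *\<^sub>R X p | s t. True}"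
proof (intro equalityI subsetI)
  fix v assume "v \<in> sharp A (wedge A Y X) p ` cotangent_space A p"
  then obtain \<alpha> where "\<alpha> \<in> cotangent_space A p" "v = sharp A (wedge A Y X) p \<alpha>" by blast
  then have "v = (- \<alpha> (X p)) *\<^sub>R Y p + \<alpha> (Y p) *\<^sub>R X p"
    using sharp_wedge[of X p Y, OF X_in_tangent_space assms(1)] by simp
  then show "v \<in> {s *\<^sub>R Y p + t *\<^sub>R X p | s t. True}" by blast
next
  fix v assume "v \<in> {s *\<^sub>R Y p + t *\<^sub>R X p | s t. True}"
  then obtain s t where v: "v = s *\<^sub>R Y p + t *\<^sub>R X p" by blast
  obtain \<beta> where \<beta>: "\<beta> \<in> cotangent_space A p" "\<beta> (X p) = 1"
    by (rule cotangent_nonzero_ex[OF X_in_tangent_space assms(3)])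
  \<comment> \<open>The aim is \<alpha>(X) = -s and \<alpha>(Y) = t. On the pair X, Y the covector
    dh takes the values 0, 1 and \<beta> the values 1, \<beta>(Y); the summand s * \<beta>(Y)
    compensates the latter.\<close>
  define \<alpha> where "\<alpha> = (\<lambda>v. (t + s * \<beta> (Y p)) * differential A h p v + (- s) * \<beta> v)"
  have \<alpha>: "\<alpha> \<in> cotangent_space A p"
    unfolding \<alpha>_def by (rule cotangent_comb[OF dh_cotangent \<beta>(1)])
  have "\<alpha> (X p) = - s" "\<alpha> (Y p) = t"
    by (simp_all add: \<alpha>_def first_integral \<beta>(2) assms(2))
  then have "sharp A (wedge A Y X) p \<alpha> = v"
    using sharp_wedge[of X p Y, OF X_in_tangent_space assms(1) \<alpha>] v by simp
  then show "v \<in> sharp A (wedge A Y X) p ` cotangent_space A p"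
    using \<alpha> by blast
qed

text \<open>X and Y span the image, and dh separates Y from all multiples of X.\<close>

lemma rank_wedge:
  assumes "Y p \<in> tangent_space A p" "differential A h p (Y p) = 1" "X p \<noteq> 0"
  shows "rank_at A (wedge A Y X) p = 2"
  unfolding rank_at_def sharp_wedge_image[of Y p, OF assms]
proof (rule real_vector.dim_unique[of "{Y p, X p}"])
  have "Y p \<noteq> k *\<^sub>R X p" for k
    using cotangent_linear[OF dh_cotangent X_in_tangent_space X_in_tangent_space, of p k 0] assms(2)
      first_integral by auto
  then have notin: "Y p \<notin> span {X p}" by (auto simp: span_singleton)
  then show "independent {Y p, X p}" using assms(3) by (simp add: independent_insert)
  have "Y p \<noteq> X p" using notin span_base by fastforce
  then show "card {Y p, X p} = 2" by simp
  have "Y p = 1 *\<^sub>R Y p + 0 *\<^sub>R X p" "X p = 0 *\<^sub>R Y p + 1 *\<^sub>R X p" by simp_all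
  then show "{Y p, X p} \<subseteq> {s *\<^sub>R Y p + t *\<^sub>R X p | s t. True}" by blast
  show "{s *\<^sub>R Y p + t *\<^sub>R X p | s t. True} \<subseteq> span {Y p, X p}"
  proof clarify
    fix s t
    show "s *\<^sub>R Y p + t *\<^sub>R X p \<in> span {Y p, X p}"
      by (intro span_add span_scale span_base) auto
  qed
qed

lemma rank_wedge_zero:
  assumes "Y p \<in> tangent_space A p" "X p = 0"
  shows "rank_at A (wedge A Y X) p = 0"
  unfolding rank_at_def
proof (rule real_vector.dim_unique[of "{}"])
  show "sharp A (wedge A Y X) p ` cotangent_space A p \<subseteq> span {}"
    using sharp_wedge[of X p Y, OF X_in_tangent_space assms(1)] assms(2)
    by (auto simp: cotangent_zero)
qed (simp_all add: real_vector.independent_empty)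

text \<open>Stated for Y instead of the bivector field, so that a factor Y is at hand whenever the
  conditions are used.\<close>

definition adapted_along :: "('a \<Rightarrow> ('a, 'm) tvec) \<Rightarrow> bool"
  where "adapted_along Y \<longleftrightarrow> (\<forall>p. sharp A (wedge A Y X) p (differential A h p) = X p) \<and>
    (\<forall>p. rank_at A (wedge A Y X) p = 2 \<longrightarrow>
      sharp A (wedge A Y X) p ` cotangent_space A p = foliation_tangent A F p)"

lemma adapted_along_normalized:
  assumes Y: "\<And>p. Y p \<in> foliation_tangent A F p" "\<And>p. differential A h p (Y p) = 1"
  shows "adapted_along Y"
  unfolding adapted_along_def
proof (intro conjI allI impI)
  fix p
  have YT: "Y p \<in> tangent_space A p"
    by (rule foliation_tangent_in_tangent_space[OF Y(1)])
  show "sharp A (wedge A Y X) p (differential A h p) = X p"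
    by (simp add: sharp_wedge_dh[of Y p, OF YT] Y(2))
  assume "rank_at A (wedge A Y X) p = 2"
  then have X0: "X p \<noteq> 0" using rank_wedge_zero[of Y p, OF YT] by auto
  have "s *\<^sub>R Y p + t *\<^sub>R X p \<in> foliation_tangent A F p" for s t
    by (rule foliation_tangent_comb[OF foliation Y(1) X_tangent])
  moreover have "\<exists>s t. v = s *\<^sub>R Y p + t *\<^sub>R X p" if "v \<in> foliation_tangent A F p" for v
    using foliation_tangent_expansion[OF that Y X0] by blast
  ultimately show "sharp A (wedge A Y X) p ` cotangent_space A p = foliation_tangent A F p"
    unfolding sharp_wedge_image[of Y p, OF YT Y(2) X0] by blast
qed

text \<open>The order matters: sharp(dh) = X gives dh(Y) = 1, this makes the rank 2, and only at
  rank 2 is the image, which contains Y, known to be the leaf plane.\<close>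

lemma adapted_along_imp_normalized:
  assumes Y: "Y p \<in> tangent_space A p" and adapted: "adapted_along Y" and X0: "X p \<noteq> 0"
  shows "differential A h p (Y p) = 1" "Y p \<in> foliation_tangent A F p"
proof -
  have "differential A h p (Y p) *\<^sub>R X p = 1 *\<^sub>R X p"
    using adapted sharp_wedge_dh[of Y p, OF Y] by (simp add: adapted_along_def)
  then show dY: "differential A h p (Y p) = 1"
    using X0 real_vector.scale_cancel_right by blast
  have "Y p = 1 *\<^sub>R Y p + 0 *\<^sub>R X p" by simp
  then have "Y p \<in> sharp A (wedge A Y X) p ` cotangent_space A p"
    unfolding sharp_wedge_image[of Y p, OF Y dY X0] by blast
  then show "Y p \<in> foliation_tangent A F p"
    using adapted rank_wedge[of Y p, OF Y dY X0] by (simp add: adapted_along_def)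
qed

lemma adapted_along_unique:
  assumes "vector_field A Y" "adapted_along Y" "vector_field A Y'" "adapted_along Y'"
  shows "wedge A Y X = wedge A Y' X"
proof
  fix p
  show "wedge A Y X p = wedge A Y' X p"
  proof (cases "X p = 0")
    case False
    show ?thesis
      using adapted_along_imp_normalized[of Y p, OF vector_field_in_tangent_space[OF assms(1)] assms(2) False]
        adapted_along_imp_normalized[of Y' p, OF vector_field_in_tangent_space[OF assms(3)] assms(4) False]
      by (intro wedge_normalized_unique False)
  qed (simp add: wedge_zero)
qed

text \<open>With y1 = h the coordinate vector of y1 is tangent to the leaf and has dh = 1. The
  uniqueness of normalized wedges is pointwise, so it applies to a field given on the chart
  only.\<close>

lemma adapted_along_in_chart:
  assumes Y: "vector_field A Y" "adapted_along Y"
    and c: "foliated_chart A F {i, j} c" and chart_h: "\<And>q. q \<in> fst c \<Longrightarrow> snd c q $ i = h q"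
    and p: "p \<in> fst c"
  shows "wedge A Y X p = wedge A (coord_vector A c i) X p"
proof (cases "X p = 0")
  case False
  have cA: "c \<in> A" and c_at: "c \<in> charts_at A p"
    using c p by (simp_all add: foliated_chart_def charts_at_def)
  have eq: "coord_vector A c i p = tangent_vector A c p (axis i 1)"
    by (rule coord_vector_eq[OF c_at])
  have v: "coord_vector A c i p \<in> tangent_space A p" "coord_vector A c i p c = axis i 1"
    unfolding eq by (rule tangent_vector_in_tangent_space[OF c_at] tangent_vector_component[OF c_at])+
  have "coord_vector A c i p \<in> foliation_tangent A F p"
    unfolding foliation_tangent_iff[OF c p] v(2) using v(1) by (auto simp: axis_def)
  moreover have "(in_chart c h has_derivative (\<lambda>v. v $ i)) (at (snd c p))"
    by (rule has_derivative_transform_within_open[OF in_chart_coordinate_has_derivative[OF c_at, of i]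
          chart_open_range[OF cA]]) (use p cA in \<open>auto simp: in_chart_at chart_h\<close>)
  then have "differential A h p (coord_vector A c i p) = 1"
    using differential_smooth_function_eq[OF h c_at v(1)] has_derivative_frechetI v(2) by fastforce
  ultimately show ?thesis
    using adapted_along_imp_normalized[of Y p, OF vector_field_in_tangent_space[OF Y(1)] Y(2) False]
    by (intro wedge_normalized_unique False)
qed (simp add: wedge_zero)

end

theorem theorem4p11:
  fixes A :: "('a::{t2_space,second_countable_topology}, 'm::finite) chart set"
    and X :: "'a \<Rightarrow> ('a, 'm) tvec"
    and h :: "'a \<Rightarrow> real"
    and F :: "'a set set"
  assumes manifold: "smooth_manifold A"
    and X: "vector_field A X"
    and h: "smooth_function A h"
    and first_integral: "\<And>p. differential A h p (X p) = 0"
    and no_critical_points: "\<And>p. differential A h p \<noteq> 0"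
    and foliation: "regular_foliation A 2 F"
    and X_tangent: "\<And>p. X p \<in> foliation_tangent A F p"
    and transversal: "transversal A F {h -` {r} | r. True}"
  shows "let adapted = (\<lambda>\<pi>.
           poisson_structure A \<pi> \<and>
           (\<exists>Y. vector_field A Y \<and> \<pi> = wedge A Y X) \<and>
           (\<forall>p. sharp A \<pi> p (differential A h p) = X p) \<and>
           (\<forall>p. rank_at A \<pi> p = 2 \<longrightarrow>
                sharp A \<pi> p ` cotangent_space A p = foliation_tangent A F p) \<and>
           (\<forall>p. X p = 0 \<longrightarrow> \<pi> p = 0))
         in (\<exists>!\<pi>. adapted \<pi>) \<and>
            (\<forall>\<pi>. adapted \<pi> \<longrightarrow>
              (\<forall>c y1 y2. y1 \<noteq> y2 \<and> foliated_chart A F {y1, y2} c \<and>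
                 (\<forall>q\<in>fst c. snd c q $ y1 = h q) \<longrightarrow>
                 (\<forall>q\<in>fst c. \<pi> q = wedge A (coord_vector A c y1) X q)))"
proof -
  interpret smooth_atlas A
    by unfold_locales (rule manifold)
  have partition: "partition_on UNIV F"
    using foliation by (simp add: regular_foliation_def)
  interpret foliation_with_first_integral A X h F
    by unfold_locales
      (rule X h first_integral foliation X_tangent
        differential_nonzero_on_foliation[OF h no_critical_points partition transversal])+
  obtain Y where Y: "vector_field A Y" "\<And>p. Y p \<in> foliation_tangent A F p"
    "\<And>p. differential A h p (Y p) = 1"
    by (rule global_normalized_field[OF h foliation dh_nonzero]) (rule that)
  note Y_adapted = adapted_along_normalized[OF Y(2,3)]
  define adapted where "adapted = (\<lambda>\<pi>.
           poisson_structure A \<pi> \<and>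
           (\<exists>Y. vector_field A Y \<and> \<pi> = wedge A Y X) \<and>
           (\<forall>p. sharp A \<pi> p (differential A h p) = X p) \<and>
           (\<forall>p. rank_at A \<pi> p = 2 \<longrightarrow>
                sharp A \<pi> p ` cotangent_space A p = foliation_tangent A F p) \<and>
           (\<forall>p. X p = 0 \<longrightarrow> \<pi> p = 0))"
  \<comment> \<open>Vanishing at the zeros of X is supplied by \<open>wedge_zero\<close>; what
    remains is a condition on the factor Y.\<close>
  have adapted: "adapted \<pi> \<longleftrightarrow> poisson_structure A \<pi> \<and>
      (\<exists>Y. vector_field A Y \<and> adapted_along Y \<and> \<pi> = wedge A Y X)" for \<pi>
    unfolding adapted_def adapted_along_def using wedge_zero by blast
  have "adapted (wedge A Y X)"
    unfolding adapted
    using poisson_structure_wedge[OF X Y(1) foliation X_tangent Y(2)] Y(1) Y_adapted by blast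
  moreover have "\<pi> = \<pi>'" if "adapted \<pi>" "adapted \<pi>'" for \<pi> \<pi>'
    using that adapted_along_unique unfolding adapted by blast
  ultimately have "\<exists>!\<pi>. adapted \<pi>" by blast
  moreover have "\<pi> q = wedge A (coord_vector A c y1) X q"
    if "adapted \<pi>" "foliated_chart A F {y1, y2} c" "\<forall>q\<in>fst c. snd c q $ y1 = h q" "q \<in> fst c"
    for \<pi> c y1 y2 q
    using that adapted_along_in_chart[OF _ _ that(2) _ that(4)] unfolding adapted by blast
  ultimately show ?thesis
    unfolding Let_def adapted_def[symmetric] by blast
qed

end
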